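(* Let $I=\langle acd+a^2c-ab,\ ad^2-c,\ ad^4+ac\rangle\subset\mathbb{Q}[a,b,c,d]$. The restricted Gröbner fan of $I$ is not the normal fan of any polyhedron in $\mathbb{R}^4$.
   Context: Let $R=k[x_1,\dots,x_n]$ (here $n=4$, $k=\mathbb{Q}$, variables $a,b,c,d$). For $\omega\in\mathbb{R}^n$ and a nonzero $f\in R$, the initial form $in_\omega(f)$ is the sum of the terms of $f$ whose exponent vectors $\alpha$ maximize $\langle \alpha,\omega\rangle$; for an ideal $I$, $in_\omega(I)=\langle in_\omega(f): f\in I\setminus\{0\}\rangle$. Define the equivalence relation $u\sim v \iff in_u(I)=in_v(I)$ on $\mathbb{R}^n$, and for $v\in\mathbb{R}^n$ let $C_v(I)=\overline{\{u\in\mathbb{R}^n: in_u(I)=in_v(I)\}}$ (closure in the usual topology). When $v$ is strictly positive, $C_v(I)$ is a convex polyhedral cone. The Gröbner fan of $I$ is the collection of all sets $C_v(I)$ for which the equivalence class of $v$ meets the positive orthant $\mathbb{R}^n_{>0}$, together with all their proper faces; this collection is a polyhedral fan. Given two fans $F,F'$ in $\mathbb{R}^n$, their common refinement is $F\wedge F'=\{C\cap C': C\in F, C'\in F'\}$. The restricted Gröbner fan of $I$ is the common refinement of the Gröbner fan of $I$ with the fan consisting of $\mathbb{R}^n_{\ge 0}$ and all its faces; its support is $\mathbb{R}^n_{\ge0}$. A polyhedron is a set $\{x\in\mathbb{R}^n: Ax\le b\}$. For a polyhedron $P$ and $\omega\in\mathbb{R}^n$, $face_\omega(P)=\{p\in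 P:\langle\omega,p\rangle=\max_{q\in P}\langle\omega,q\rangle\}$; every nonempty face $F$ of $P$ arises this way, and its normal cone is $N_P(F)=\overline{\{\omega\in\mathbb{R}^n: face_\omega(P)=F\}}$. The normal fan of $P$ is the set of cones $N_P(F)$ as $F$ ranges over the nonempty faces of $P$. *)

theory Defs
  imports "HOL-Analysis.Analysis" "HOL-Library.Poly_Mapping"
begin

text \<open>Polynomials over \<open>'k\<close> with variables indexed by \<open>'n\<close>: finitely supported maps from
  exponent vectors to coefficients, multiplied by convolution.\<close>

type_synonym ('n, 'k) mpoly = "('n \<Rightarrow>\<^sub>0 nat) \<Rightarrow>\<^sub>0 'k"

definition var :: "'n \<Rightarrow> ('n, 'k::comm_ring_1) mpoly" where
  "var i = Poly_Mapping.single (Poly_Mapping.single i 1) 1"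

definition ideal_of :: "'a::comm_ring_1 set \<Rightarrow> 'a set" where
  "ideal_of S = module.span (*) S"

lemma module_mult: "module ((*) :: 'a::comm_ring_1 \<Rightarrow> 'a \<Rightarrow> 'a)"
  by unfold_locales (simp_all add: algebra_simps)

lemma ideal_of_explicit: "ideal_of S = {\<Sum>p\<in>T. q p * p |T q. finite T \<and> T \<subseteq> S}"
  unfolding ideal_of_def by (rule module.span_explicit [OF module_mult])

definition exponent :: "('n::finite \<Rightarrow>\<^sub>0 nat) \<Rightarrow> real^'n" where
  "exponent \<alpha> = (\<chi> i. real (Poly_Mapping.lookup \<alpha> i))"

definition initial_form :: "real^'n \<Rightarrow> ('n::finite, 'k::comm_ring_1) mpoly \<Rightarrow> ('n, 'k) mpoly" where
  "initial_form \<omega> f =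
     (\<Sum>\<alpha> \<in> {\<alpha> \<in> Poly_Mapping.keys f.
               \<forall>\<beta> \<in> Poly_Mapping.keys f. exponent \<beta> \<bullet> \<omega> \<le> exponent \<alpha> \<bullet> \<omega>}.
        Poly_Mapping.single \<alpha> (Poly_Mapping.lookup f \<alpha>))"

definition initial_ideal ::
    "real^'n \<Rightarrow> ('n::finite, 'k::comm_ring_1) mpoly set \<Rightarrow> ('n, 'k) mpoly set" where
  "initial_ideal \<omega> I = ideal_of {initial_form \<omega> f |f. f \<in> I \<and> f \<noteq> 0}"

definition groebner_cone ::
    "('n::finite, 'k::comm_ring_1) mpoly set \<Rightarrow> real^'n \<Rightarrow> (real^'n) set" where
  "groebner_cone I v = closure {u. initial_ideal u I = initial_ideal v I}"

definition face :: "'a::real_inner \<Rightarrow> 'a set \<Rightarrow> 'a set" where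
  "face \<omega> P = {p \<in> P. \<forall>q \<in> P. \<omega> \<bullet> q \<le> \<omega> \<bullet> p}"

text \<open>The set \<^term>\<open>face \<omega> P\<close> is empty when the linear form \<open>\<omega>\<close> is unbounded above on \<open>P\<close>.
  The empty set is excluded here, so it is never a member of the fans below.\<close>

definition nonempty_faces :: "'a::real_inner set \<Rightarrow> 'a set set" where
  "nonempty_faces P = {face \<omega> P |\<omega>. face \<omega> P \<noteq> {}}"

definition groebner_fan ::
    "('n::finite, 'k::comm_ring_1) mpoly set \<Rightarrow> (real^'n) set set" where
  "groebner_fan I =
     (let \<C> = {groebner_cone I v |v.
                 \<exists>u. initial_ideal u I = initial_ideal v I \<and> (\<forall>i. 0 < u $ i)}
      in \<C> \<union> (\<Union>C\<in>\<C>. {F \<in> nonempty_faces C. F \<noteq> C}))"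

definition common_refinement :: "'a set set \<Rightarrow> 'a set set \<Rightarrow> 'a set set" where
  "common_refinement \<F> \<G> = {C \<inter> D |C D. C \<in> \<F> \<and> D \<in> \<G>}"

definition nonneg_orthant :: "(real^'n::finite) set" where
  "nonneg_orthant = {x. \<forall>i. 0 \<le> x $ i}"

definition restricted_groebner_fan ::
    "('n::finite, 'k::comm_ring_1) mpoly set \<Rightarrow> (real^'n) set set" where
  "restricted_groebner_fan I =
     common_refinement (groebner_fan I) (insert nonneg_orthant (nonempty_faces nonneg_orthant))"

definition normal_cone :: "'a::real_inner set \<Rightarrow> 'a set \<Rightarrow> 'a set" where
  "normal_cone P F = closure {\<omega>. face \<omega> P = F}"

definition normal_fan :: "'a::real_inner set \<Rightarrow> 'a set set" where
  "normal_fan P = {normal_cone P F |F. F \<in> nonempty_faces P}"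

end

(*
  The support function of a polyhedron is additive on every cone of its normal fan and strictly
  subadditive across two cones. Choosing, for ten maximal cones of the Groebner fan, a point p_i of
  the polyhedron whose normal cone contains the i-th cone gives inequalities
  <u, p_j> <= <u, p_i> for u in the i-th cone. Twenty-three of them add up to 0 <= 0, so all are
  equalities. Hence a ray u of one cone and an interior vector of another cone, which does not
  contain u, would lie in a common cone of the fan, and this is impossible.

  To identify the ten cones, let N = <c, ab, ad^2> and let phi be the substitution
  a = -t^2, b = t^6 - t^5, c = -t^4, d = t. The ideal consists of the polynomials in N that are
  killed by phi. So a finite set of its elements is a Groebner basis for every positive weight that
  selects the given leading terms as soon as the monomials of N that are not divisible by any of
  these terms have linearly independent images under phi. Independence does not depend on the
  weight; it is transported from cone to cone by exchanging strings b^n p for strings b^n q along a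
  relation in the kernel, starting from the monomials b^n c d^l, l < 6, whose images have distinct
  degrees.
*)

theory Submission
  imports Defs "HOL-Computational_Algebra.Polynomial"
begin

section \<open>Ideals, monomials and the substitution\<close>

text \<open>The kernel of phi alone is too large: it contains a + d^2, whose monomials lie outside
  N. Intersecting with N repairs this, but that the intersection is no larger than the ideal is
  itself a membership problem. An eleventh basis, \<open>G0\<close>, breaks the circle: its elements
  are combined explicitly from the generators, and the independence that it needs is visible from
  degrees. From then on, membership in the ideal is a polynomial identity in t together with a look
  at exponents. The cones are never computed. A strictly dominant integer weight shows that a cone
  occurs in the fan, weak inequalities put selected rays into it, and a single non-membership is
  established. Many of the exchange relations are basis elements in which two of the cones select
  different leading terms.\<close>

lemma ideal_of_base: "x \<in> S \<Longrightarrow> x \<in> ideal_of S"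
  unfolding ideal_of_def by (rule module.span_base [OF module_mult])

lemma ideal_of_0: "0 \<in> ideal_of S"
  unfolding ideal_of_def by (rule module.span_zero [OF module_mult])

lemma ideal_of_add: "x \<in> ideal_of S \<Longrightarrow> y \<in> ideal_of S \<Longrightarrow> x + y \<in> ideal_of S"
  unfolding ideal_of_def by (rule module.span_add [OF module_mult])

lemma ideal_of_diff: "x \<in> ideal_of S \<Longrightarrow> y \<in> ideal_of S \<Longrightarrow> x - y \<in> ideal_of S"
  unfolding ideal_of_def by (rule module.span_diff [OF module_mult])

lemma ideal_of_mult: "x \<in> ideal_of S \<Longrightarrow> r * x \<in> ideal_of S"
  unfolding ideal_of_def by (rule module.span_scale [OF module_mult])

lemma ideal_of_sum: "(\<And>i. i \<in> A \<Longrightarrow> f i \<in> ideal_of S) \<Longrightarrow> sum f A \<in> ideal_of S"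
  unfolding ideal_of_def by (rule module.span_sum [OF module_mult])

lemma ideal_of_least:
  assumes "S \<subseteq> K" "0 \<in> K" "\<And>x y. x \<in> K \<Longrightarrow> y \<in> K \<Longrightarrow> x + y \<in> K" "\<And>r x. x \<in> K \<Longrightarrow> r * x \<in> K"
  shows "ideal_of S \<subseteq> K"
  unfolding ideal_of_def
  by (rule module.span_minimal [OF module_mult assms(1)])
     (simp add: module.subspace_def [OF module_mult] assms(2-4))

text \<open>Exponent vectors \<open>(i, j, k, l)\<close> stand for the monomials \<open>a\<^sup>i b\<^sup>j c\<^sup>k d\<^sup>l\<close>; note that
  \<open>4 = 0\<close> in the index type.\<close>

type_synonym expt = "nat \<times> nat \<times> nat \<times> nat"

fun expo :: "expt \<Rightarrow> 4 \<Rightarrow>\<^sub>0 nat" where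
  "expo (i, j, k, l) = Poly_Mapping.single 1 i + Poly_Mapping.single 2 j
     + Poly_Mapping.single 3 k + Poly_Mapping.single 4 l"

declare expo.simps [simp del]

lemma lookup_expo [simp]:
  "Poly_Mapping.lookup (expo (i, j, k, l)) 1 = i"
  "Poly_Mapping.lookup (expo (i, j, k, l)) 2 = j"
  "Poly_Mapping.lookup (expo (i, j, k, l)) 3 = k"
  "Poly_Mapping.lookup (expo (i, j, k, l)) 4 = l"
  by (simp_all add: expo.simps lookup_add lookup_single)

lemma inj_expo: "inj expo"
proof (rule injI)
  fix e e' :: expt
  assume *: "expo e = expo e'"
  obtain i j k l i' j' k' l' where e: "e = (i, j, k, l)" "e' = (i', j', k', l')"
    by (metis prod_cases4)
  show "e = e'"
    using arg_cong [OF *, of "\<lambda>\<alpha>. Poly_Mapping.lookup \<alpha> 1"] arg_cong [OF *, of "\<lambda>\<alpha>.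
      Poly_Mapping.lookup \<alpha> 2"]
      arg_cong [OF *, of "\<lambda>\<alpha>. Poly_Mapping.lookup \<alpha> 3"] arg_cong [OF *, of "\<lambda>\<alpha>. Poly_Mapping.lookup \<alpha>
        4"]
    unfolding e by (simp only: lookup_expo)
qed

lemma expo_eq_iff [simp]: "expo e = expo e' \<longleftrightarrow> e = e'"
  using inj_expo by (auto dest: injD)

lemma expo_lookup:
  "expo (Poly_Mapping.lookup \<alpha> 1, Poly_Mapping.lookup \<alpha> 2, Poly_Mapping.lookup \<alpha> 3,
     Poly_Mapping.lookup \<alpha> 4) = \<alpha>"
proof (rule poly_mapping_eqI)
  fix k :: 4
  have "k = 1 \<or> k = 2 \<or> k = 3 \<or> k = 4" by (rule exhaust_4)
  then show "Poly_Mapping.lookup (expo (Poly_Mapping.lookup \<alpha> 1, Poly_Mapping.lookup \<alpha> 2,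
     Poly_Mapping.lookup \<alpha> 3, Poly_Mapping.lookup \<alpha> 4)) k = Poly_Mapping.lookup \<alpha> k"
    by (elim disjE) (simp_all only: lookup_expo)
qed

lemma expo_cases: obtains e where "\<alpha> = expo e"
  using expo_lookup by metis

lemma expo_add: "expo (e + e') = expo e + expo e'"
  by (cases e; cases e') (simp add: expo.simps single_add algebra_simps)

abbreviation trm :: "rat \<Rightarrow> expt \<Rightarrow> (4, rat) mpoly" where
  "trm c e \<equiv> Poly_Mapping.single (expo e) c"

lemma trm_mult: "trm c e * trm c' e' = trm (c * c') (e + e')"
  by (simp add: mult_single expo_add)

lemma poly_mapping_sum_single:
  assumes "finite A" "Poly_Mapping.keys f \<subseteq> A"
  shows "(\<Sum>\<alpha>\<in>A. Poly_Mapping.single \<alpha> (Poly_Mapping.lookup f \<alpha>)) = f"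
proof (rule poly_mapping_eqI)
  fix k
  have "(\<Sum>\<alpha>\<in>A. Poly_Mapping.lookup (Poly_Mapping.single \<alpha> (Poly_Mapping.lookup f \<alpha>)) k)
      = (\<Sum>\<alpha>\<in>A. if \<alpha> = k then Poly_Mapping.lookup f k else 0)"
    by (intro sum.cong) (auto simp: lookup_single)
  also have "\<dots> = Poly_Mapping.lookup f k"
    using assms by (auto simp: in_keys_iff)
  finally show "Poly_Mapping.lookup (\<Sum>\<alpha>\<in>A. Poly_Mapping.single \<alpha> (Poly_Mapping.lookup f \<alpha>)) k
      = Poly_Mapping.lookup f k"
    by (simp add: lookup_sum)
qed

text \<open>The parametrised curve \<open>(-t\<^sup>2, t\<^sup>6 - t\<^sup>5, -t\<^sup>4, t)\<close>.\<close>

definition ev :: "(4 \<Rightarrow>\<^sub>0 nat) \<Rightarrow> rat poly" where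
  "ev \<alpha> = (- ([:0, 1:] ^ 2)) ^ Poly_Mapping.lookup \<alpha> 1 * ([:0, 1:] ^ 6 - [:0, 1:] ^ 5) ^
    Poly_Mapping.lookup \<alpha> 2
     * (- ([:0, 1:] ^ 4)) ^ Poly_Mapping.lookup \<alpha> 3 * [:0, 1:] ^ Poly_Mapping.lookup \<alpha> 4"

definition phi :: "(4, rat) mpoly \<Rightarrow> rat poly" where
  "phi f = (\<Sum>\<alpha>\<in>Poly_Mapping.keys f. smult (Poly_Mapping.lookup f \<alpha>) (ev \<alpha>))"

lemma ev_add: "ev (\<alpha> + \<beta>) = ev \<alpha> * ev \<beta>"
  by (simp add: ev_def lookup_add power_add mult_ac)

lemma phi_superset:
  assumes "finite A" "Poly_Mapping.keys f \<subseteq> A"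
  shows "phi f = (\<Sum>\<alpha>\<in>A. smult (Poly_Mapping.lookup f \<alpha>) (ev \<alpha>))"
  unfolding phi_def using assms by (intro sum.mono_neutral_left) (auto simp: in_keys_iff)

lemma phi_0 [simp]: "phi 0 = 0"
  by (simp add: phi_def)

lemma phi_add: "phi (f + g) = phi f + phi g"
proof -
  let ?A = "Poly_Mapping.keys f \<union> Poly_Mapping.keys g"
  have "phi (f + g) = (\<Sum>\<alpha>\<in>?A. smult (Poly_Mapping.lookup (f + g) \<alpha>) (ev \<alpha>))"
    using keys_add [of f g] by (intro phi_superset) auto
  also have "\<dots> = (\<Sum>\<alpha>\<in>?A. smult (Poly_Mapping.lookup f \<alpha>) (ev \<alpha>))
      + (\<Sum>\<alpha>\<in>?A. smult (Poly_Mapping.lookup g \<alpha>) (ev \<alpha>))"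
    by (simp add: lookup_add smult_add_left sum.distrib)
  also have "\<dots> = phi f + phi g"
    by (simp add: phi_superset [of ?A f] phi_superset [of ?A g])
  finally show ?thesis .
qed

lemma phi_sum: "phi (sum F A) = (\<Sum>i\<in>A. phi (F i))"
  by (induction A rule: infinite_finite_induct) (auto simp: phi_add)

lemma phi_single: "phi (Poly_Mapping.single \<alpha> c) = smult c (ev \<alpha>)"
  by (subst phi_superset [of "{\<alpha>}"]) auto

lemma phi_mult: "phi (f * g) = phi f * phi g"
proof -
  let ?F = "\<lambda>h \<alpha>. Poly_Mapping.single \<alpha> (Poly_Mapping.lookup h \<alpha>)"
  have "f * g = (\<Sum>\<alpha>\<in>Poly_Mapping.keys f. \<Sum>\<beta>\<in>Poly_Mapping.keys g. ?F f \<alpha> * ?F g \<beta>)"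
    by (simp add: sum_product [symmetric] poly_mapping_sum_single)
  then have "phi (f * g) = phi (\<Sum>\<alpha>\<in>Poly_Mapping.keys f. \<Sum>\<beta>\<in>Poly_Mapping.keys g. ?F f \<alpha> * ?F g \<beta>)"
    by (rule arg_cong)
  also have "\<dots> = (\<Sum>\<alpha>\<in>Poly_Mapping.keys f. \<Sum>\<beta>\<in>Poly_Mapping.keys g.
      smult (Poly_Mapping.lookup f \<alpha>) (ev \<alpha>) * smult (Poly_Mapping.lookup g \<beta>) (ev \<beta>))"
    by (simp add: phi_sum phi_single mult_single ev_add) (simp add: mult.commute)
  finally show ?thesis
    by (simp only: phi_def sum_product)
qed

lemma lookup_single_mult:
  fixes f :: "(4, rat) mpoly"
  shows "Poly_Mapping.lookup (Poly_Mapping.single \<alpha> c * f) (\<alpha> + \<beta>) = c * Poly_Mapping.lookup f \<beta>"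
proof -
  have "Poly_Mapping.single \<alpha> c * f
      = (\<Sum>\<gamma>\<in>Poly_Mapping.keys f. Poly_Mapping.single (\<alpha> + \<gamma>) (c * Poly_Mapping.lookup f \<gamma>))"
    by (subst poly_mapping_sum_single [of "Poly_Mapping.keys f" f, symmetric])
       (simp_all add: sum_distrib_left mult_single)
  then have "Poly_Mapping.lookup (Poly_Mapping.single \<alpha> c * f) (\<alpha> + \<beta>)
      = (\<Sum>\<gamma>\<in>Poly_Mapping.keys f. if \<gamma> = \<beta> then c * Poly_Mapping.lookup f \<beta> else 0)"
    by (simp only:) (intro trans [OF lookup_sum] sum.cong, auto simp: lookup_single)
  also have "\<dots> = c * Poly_Mapping.lookup f \<beta>"
    by (auto simp: in_keys_iff)
  finally show ?thesis .
qed

lemma keys_single_mult: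
  "Poly_Mapping.keys (Poly_Mapping.single \<alpha> c * f) \<subseteq> (+) \<alpha> ` Poly_Mapping.keys (f :: (4, rat) mpoly)"
  using keys_mult [of "Poly_Mapping.single \<alpha> c" f] by (auto split: if_splits)

lemma phi_diff: "phi (f - g) = phi f - phi g"
  using phi_add [of "f - g" g] by simp

section \<open>Linear independence of strings of monomials\<close>

text \<open>Injectivity of \<open>phi\<close> on the span of the monomials in \<open>S\<close>.
  Stated for polynomials instead of the family of images, it also makes two distinct monomials with
  equal images dependent.\<close>

definition indep :: "expt set \<Rightarrow> bool" where
  "indep S \<longleftrightarrow> (\<forall>f. Poly_Mapping.keys f \<subseteq> expo ` S \<longrightarrow> phi f = 0 \<longrightarrow> f = 0)"

lemma indepD: "indep S \<Longrightarrow> Poly_Mapping.keys f \<subseteq> expo ` S \<Longrightarrow> phi f = 0 \<Longrightarrow> f = 0"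
  by (simp add: indep_def)

lemma indep_mono: "indep S \<Longrightarrow> S' \<subseteq> S \<Longrightarrow> indep S'"
  unfolding indep_def by (meson image_mono subset_trans)

fun wdeg :: "expt \<Rightarrow> nat" where
  "wdeg (i, j, k, l) = 2 * i + 6 * j + 4 * k + l"

declare wdeg.simps [simp del]

lemma ev_expo: "ev (expo (i, j, k, l)) = smult ((-1) ^ (i + k)) (monom 1 (2 * i + 5 * j + 4 * k + l) *
  [:-1, 1:] ^ j)"
proof -
  have x: "[:0, 1:] = monom (1 :: rat) 1"
    by (simp add: monom_Suc)
  define q where "q = [:-1, 1 :: rat:]"
  have b: "[:0, 1:] ^ 6 - [:0, 1:] ^ 5 = monom (1 :: rat) 5 * q"
  proof -
    have "q = [:0, 1:] - 1" by (simp add: q_def one_pCons)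
    moreover have "p ^ 6 - p ^ 5 = p ^ 5 * (p - 1)" for p :: "rat poly"
      by (simp add: algebra_simps eval_nat_numeral)
    ultimately have "[:0, 1:] ^ 6 - [:0, 1:] ^ 5 = [:0, 1 :: rat:] ^ 5 * q"
      by (simp only:)
    then show ?thesis by (simp add: x monom_power)
  qed
  have neg: "(- p) ^ n = smult ((-1) ^ n) (p ^ n)" for p :: "rat poly" and n
    by (induction n) simp_all
  have "ev (expo (i, j, k, l)) = smult ((-1) ^ (i + k))
      ((monom 1 (2 * i) * monom 1 (5 * j) * monom 1 (4 * k) * monom 1 l) * q ^ j)"
    unfolding ev_def lookup_expo b neg unfolding x
    by (simp only: power_mult_distrib monom_power power_one power_add mult_1 mult_smult_left
        mult_smult_right smult_smult mult_ac)
  then show ?thesis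
    unfolding q_def [symmetric] by (simp only: mult_monom mult_1)
qed

lemma degree_ev: "degree (ev (expo e)) = wdeg e" and ev_nonzero: "ev (expo e) \<noteq> 0"
proof -
  obtain i j k l where e: "e = (i, j, k, l)" by (metis prod_cases4)
  have "degree ([:-1, 1 :: rat:] ^ j) = j"
    by (simp add: degree_power_eq)
  then show "degree (ev (expo e)) = wdeg e" "ev (expo e) \<noteq> 0"
    by (simp_all add: e ev_expo wdeg.simps degree_mult_eq degree_monom_eq monom_eq_0_iff)
qed

text \<open>Only one monomial of the support reaches the largest degree that occurs, so nothing can
  cancel its leading coefficient.\<close>

lemma indep_wdeg:
  assumes "inj_on wdeg S"
  shows "indep S"
  unfolding indep_def
proof (intro allI impI)
  fix f
  assume keys: "Poly_Mapping.keys f \<subseteq> expo ` S" and 0: "phi f = 0"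
  show "f = 0"
  proof (rule ccontr)
    assume "f \<noteq> 0"
    define E where "E = {e. expo e \<in> Poly_Mapping.keys f}"
    have "E = expo -` Poly_Mapping.keys f" by (auto simp: E_def)
    then have fin: "finite E" by (simp add: finite_vimageI inj_expo)
    have sub: "E \<subseteq> S" using keys by (auto simp: E_def)
    have keysE: "Poly_Mapping.keys f = expo ` E"
      using keys by (auto simp: E_def)
    then have "E \<noteq> {}" using \<open>f \<noteq> 0\<close> by auto
    then have "Max (wdeg ` E) \<in> wdeg ` E" using fin by (intro Max_in) auto
    then obtain e where "e \<in> E" "wdeg e = Max (wdeg ` E)" by auto
    with fin have e: "e \<in> E" "\<And>e'. e' \<in> E \<Longrightarrow> wdeg e' \<le> wdeg e" by simp_all
    have lt: "wdeg e' < wdeg e" if "e' \<in> E" "e' \<noteq> e" for e'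
      using e that assms sub by (metis inj_onD le_neq_implies_less subsetD)
    have "coeff (phi f) (wdeg e)
        = (\<Sum>e'\<in>E. Poly_Mapping.lookup f (expo e') * coeff (ev (expo e')) (wdeg e))"
      unfolding phi_def keysE by (simp add: sum.reindex inj_on_def coeff_sum)
    also have "\<dots> = (\<Sum>e'\<in>E. if e' = e then Poly_Mapping.lookup f (expo e) * coeff (ev (expo e)) (wdeg
      e) else 0)"
      by (intro sum.cong refl) (auto simp: lt degree_ev intro!: coeff_eq_0)
    also have "\<dots> = Poly_Mapping.lookup f (expo e) * lead_coeff (ev (expo e))"
      using fin e by (simp add: degree_ev)
    also have "\<dots> \<noteq> 0"
      using e ev_nonzero by (auto simp: E_def in_keys_iff)
    finally show False using 0 by simp
  qed
qed

lemma phi_const_mult: "phi (Poly_Mapping.single 0 c * f) = smult c (phi f)"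
  by (simp add: phi_mult phi_single ev_def)

text \<open>A Steinitz exchange for a possibly infinite family at once. The relation with index j
  trades \<open>q j\<close> for \<open>p j\<close>, modulo \<open>R\<close> and the
  \<open>p i\<close> with i < j. This triangular shape makes the change of basis invertible, and it
  admits relations whose tail runs into the family being removed.\<close>

lemma indep_exchange:
  fixes p q :: "nat \<Rightarrow> expt"
  assumes indep: "indep (p ` J \<union> R)"
    and inj: "inj_on p J" "inj_on q J"
    and disj: "p ` J \<inter> R = {}" "q ` J \<inter> R = {}"
    and rel: "\<And>j. j \<in> J \<Longrightarrow> phi (trm cp (p j) + trm cq (q j) + \<rho> j) = 0"
    and keys: "\<And>j. j \<in> J \<Longrightarrow> Poly_Mapping.keys (\<rho> j) \<subseteq> expo ` (R \<union> p ` {i \<in> J. i < j})"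
    and nz: "cp \<noteq> 0" "cq \<noteq> 0"
  shows "indep (q ` J \<union> R)"
  unfolding indep_def
proof (intro allI impI)
  fix f
  assume f: "Poly_Mapping.keys f \<subseteq> expo ` (q ` J \<union> R)" and f0: "phi f = 0"
  define K where "K = {j \<in> J. expo (q j) \<in> Poly_Mapping.keys f}"
  define co where "co j = Poly_Mapping.lookup f (expo (q j)) / cq" for j
  define fR where "fR = (\<Sum>\<alpha>\<in>Poly_Mapping.keys f \<inter> expo ` R. Poly_Mapping.single \<alpha> (Poly_Mapping.lookup
    f \<alpha>))"
  \<comment> \<open>Every \<open>q j\<close> in \<open>f\<close> is eliminated at the price of
    \<open>p j\<close> and a tail. Hence \<open>h\<close> is supported on the set known to be
    independent and has to vanish.\<close>
  define h where "h = f - (\<Sum>j\<in>K. Poly_Mapping.single 0 (co j) * (trm cp (p j) + trm cq (q j) + \<rho> j))"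
  have "inj_on (\<lambda>j. expo (q j)) K"
    using inj(2) by (auto simp: inj_on_def K_def)
  moreover have "(\<lambda>j. expo (q j)) ` K \<subseteq> Poly_Mapping.keys f"
    by (auto simp: K_def)
  ultimately have finK: "finite K"
    by (meson finite_keys inj_on_finite)
  have split: "Poly_Mapping.keys f = (\<lambda>j. expo (q j)) ` K \<union> (Poly_Mapping.keys f \<inter> expo ` R)"
    using f by (auto simp: K_def)
  have "f = (\<Sum>\<alpha>\<in>Poly_Mapping.keys f. Poly_Mapping.single \<alpha> (Poly_Mapping.lookup f \<alpha>))"
    by (simp add: poly_mapping_sum_single)
  also have "\<dots> = (\<Sum>\<alpha>\<in>(\<lambda>j. expo (q j)) ` K. Poly_Mapping.single \<alpha> (Poly_Mapping.lookup f \<alpha>)) + fR"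
    unfolding fR_def using disj(2) finK
    by (subst split, subst sum.union_disjoint) (auto simp: K_def)
  also have "(\<Sum>\<alpha>\<in>(\<lambda>j. expo (q j)) ` K. Poly_Mapping.single \<alpha> (Poly_Mapping.lookup f \<alpha>))
      = (\<Sum>j\<in>K. trm (co j * cq) (q j))"
    using \<open>inj_on (\<lambda>j. expo (q j)) K\<close> nz by (simp add: sum.reindex co_def)
  finally have f_eq: "f = (\<Sum>j\<in>K. trm (co j * cq) (q j)) + fR" .
  have h_eq: "h = fR - (\<Sum>j\<in>K. trm (co j * cp) (p j)) - (\<Sum>j\<in>K. Poly_Mapping.single 0 (co j) * \<rho> j)"
    unfolding h_def by (subst f_eq) (simp add: distrib_left mult_single sum.distrib)
  have keys_fR: "Poly_Mapping.keys fR \<subseteq> expo ` R"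
    unfolding fR_def by (rule order_trans [OF keys_sum]) (auto split: if_splits)
  have keys2: "\<exists>j\<in>K. \<alpha> \<in> expo ` (R \<union> p ` {i \<in> J. i < j})"
    if \<alpha>: "\<alpha> \<in> Poly_Mapping.keys (\<Sum>j\<in>K. Poly_Mapping.single 0 (co j) * \<rho> j)" for \<alpha>
  proof -
    obtain j where "j \<in> K" "\<alpha> \<in> Poly_Mapping.keys (Poly_Mapping.single 0 (co j) * \<rho> j)"
      using subsetD [OF keys_sum \<alpha>] by blast
    then have "\<alpha> \<in> Poly_Mapping.keys (\<rho> j)"
      using keys_single_mult [of 0 "co j" "\<rho> j"] by auto
    then show ?thesis
      using keys [of j] \<open>j \<in> K\<close> by (auto simp: K_def)
  qed
  then have keys2': "Poly_Mapping.keys (\<Sum>j\<in>K. Poly_Mapping.single 0 (co j) * \<rho> j)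
      \<subseteq> expo ` p ` J \<union> expo ` R"
    by blast
  have keys1: "Poly_Mapping.keys (\<Sum>j\<in>K. trm (co j * cp) (p j)) \<subseteq> expo ` p ` J"
    by (rule order_trans [OF keys_sum]) (auto simp: K_def split: if_splits)
  have "Poly_Mapping.keys h \<subseteq> expo ` (p ` J \<union> R)"
    unfolding h_eq image_Un using keys_fR keys1 keys2'
    by (intro order_trans [OF keys_diff] Un_least) auto
  moreover have "phi h = 0"
    unfolding h_def using rel by (auto simp: phi_diff phi_sum f0 phi_const_mult K_def)
  ultimately have "h = 0" using indep by (blast intro: indepD)
  have "K = {}"
  proof (rule ccontr)
    assume "K \<noteq> {}"
    \<comment> \<open>At the largest index, no tail reaches \<open>p j\<close>, because tails
      contain only \<open>p i\<close> with i smaller than some index in \<open>K\<close>. So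
      \<open>h\<close> has coefficient \<open>- (co j * cp)\<close> there.\<close>
    then have j: "Max K \<in> K" and le: "\<And>i. i \<in> K \<Longrightarrow> i \<le> Max K" using finK by simp_all
    define j where "j = Max K"
    note j = j [folded j_def] and le = le [folded j_def]
    have notR: "expo (p j) \<notin> expo ` R" using disj(1) j by (auto simp: K_def)
    have "Poly_Mapping.lookup fR (expo (p j)) = 0"
      "Poly_Mapping.lookup (\<Sum>j\<in>K. Poly_Mapping.single 0 (co j) * \<rho> j) (expo (p j)) = 0"
    proof -
      show "Poly_Mapping.lookup fR (expo (p j)) = 0"
        using notR keys_fR by (meson in_keys_iff subsetD)
      have "p j \<notin> p ` {i' \<in> J. i' < i}" if "i \<in> K" for i
        using le [OF that] j inj(1) by (fastforce simp: K_def inj_on_def)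
      then have "expo (p j) \<notin> Poly_Mapping.keys (\<Sum>j\<in>K. Poly_Mapping.single 0 (co j) * \<rho> j)"
        using keys2 [of "expo (p j)"] notR by (auto simp: inj_image_mem_iff [OF inj_expo])
      then show "Poly_Mapping.lookup (\<Sum>j\<in>K. Poly_Mapping.single 0 (co j) * \<rho> j) (expo (p j)) = 0"
        by (simp add: in_keys_iff)
    qed
    then have "Poly_Mapping.lookup h (expo (p j))
        = - (\<Sum>i\<in>K. Poly_Mapping.lookup (trm (co i * cp) (p i)) (expo (p j)))"
      unfolding h_eq lookup_minus lookup_sum [symmetric] by simp
    also have "\<dots> = - (\<Sum>i\<in>K. if i = j then co j * cp else 0)"
      using inj(1) j by (intro arg_cong [of _ _ uminus] sum.cong) (auto simp: lookup_single K_def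
        inj_on_def when_def)
    also have "\<dots> = - (co j * cp)" using finK j by simp
    finally have "co j = 0" using nz \<open>h = 0\<close> by simp
    then show False using j nz by (simp add: co_def K_def in_keys_iff)
  qed
  then have "f = fR" using f_eq by simp
  then show "f = 0" using keys_fR f0 indep by (metis (no_types, lifting) image_Un indepD le_supI2)
qed

text \<open>A pair \<open>(e, True)\<close> stands for the infinite string of monomials \<open>e, b e, b\<^sup>2 e, \<dots>\<close>, and
  \<open>(e, False)\<close> for \<open>e\<close> alone.\<close>

fun in_string :: "expt \<Rightarrow> expt \<times> bool \<Rightarrow> bool" where
  "in_string (i, j, k, l) ((i', j', k', l'), u) \<longleftrightarrow>
     i = i' \<and> k = k' \<and> l = l' \<and> (if u then j' \<le> j else j = j')"

definition cells :: "(expt \<times> bool) list \<Rightarrow> expt set" where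
  "cells T = {m. list_ex (in_string m) T}"

text \<open>A finite test for an infinite inclusion: some string of \<open>T\<close> on the same
  line takes over from b-exponent j' on, and only the exponents below j' are inspected. The interval
  is empty if the start is already inside that string.\<close>

fun tail_in :: "(expt \<times> bool) list \<Rightarrow> expt \<Rightarrow> bool" where
  "tail_in T (i, j, k, l) \<longleftrightarrow> list_ex (\<lambda>((i', j', k', l'), u). u \<and> i = i' \<and> k = k' \<and> l = l' \<and>
      list_all (\<lambda>n. list_ex (in_string (i, n, k, l)) T) [j..<j']) T"

fun covers :: "(expt \<times> bool) list \<Rightarrow> expt \<times> bool \<Rightarrow> bool" where
  "covers T (e, u) \<longleftrightarrow> (if u then tail_in T e else list_ex (in_string e) T)"

fun apart :: "expt \<times> bool \<Rightarrow> expt \<times> bool \<Rightarrow> bool" where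
  "apart ((i, j, k, l), u) ((i', j', k', l'), u') \<longleftrightarrow>
     i \<noteq> i' \<or> k \<noteq> k' \<or> l \<noteq> l' \<or> (\<not> u \<and> j < j') \<or> (\<not> u' \<and> j' < j)"

lemma tail_inD:
  assumes "tail_in T e"
  shows "e + (0, n, 0, 0) \<in> cells T"
proof -
  obtain i j k l where e: "e = (i, j, k, l)" by (metis prod_cases4)
  obtain j' where 1: "((i, j', k, l), True) \<in> set T" and 2: "\<forall>n\<in>{j..<j'}. (i, n, k, l) \<in> cells T"
    using assms by (auto simp: e list_ex_iff list_all_iff cells_def)
  show ?thesis
  proof (cases "j + n < j'")
    case True
    then show ?thesis using 2 by (auto simp: e)
  next
    case False
    then show ?thesis using 1 by (auto simp: e cells_def list_ex_iff intro!: bexI [OF _ 1])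
  qed
qed

lemma in_string_iff:
  "in_string m (e, u) \<longleftrightarrow> (\<exists>n. (u \<or> n = 0) \<and> m = e + (0, n, 0, 0))"
  by (cases m; cases e) (auto simp: le_iff_add)

lemma coversD: "covers T (e, u) \<Longrightarrow> in_string m (e, u) \<Longrightarrow> m \<in> cells T"
  using tail_inD [of T e] by (auto simp: in_string_iff cells_def zero_prod_def [symmetric] split:
    if_splits)

lemma cells_mono: "list_all (covers T) T' \<Longrightarrow> cells T' \<subseteq> cells T"
  by (auto simp: cells_def list_all_iff list_ex_iff dest!: bspec intro: coversD [unfolded cells_def
    list_ex_iff mem_Collect_eq])

lemma cells_Cons: "cells ((e, u) # T) = (\<lambda>n. e + (0, n, 0, 0)) ` (if u then UNIV else {0}) \<union> cells T"
  by (auto simp: cells_def in_string_iff)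

lemma apartD: "apart s s' \<Longrightarrow> in_string m s \<Longrightarrow> \<not> in_string m s'"
  by (cases s; cases s'; cases m) (auto split: if_splits)

lemma apart_cells:
  assumes "list_all (apart (e, u)) R"
  shows "(\<lambda>n. e + (0, n, 0, 0)) ` (if u then UNIV else {0}) \<inter> cells R = {}"
proof -
  have "in_string (e + (0, n, 0, 0)) (e, u)" if "n \<in> (if u then UNIV else {0})" for n
    using that unfolding in_string_iff by (auto split: if_splits)
  then show ?thesis
    using assms apartD unfolding cells_def list_ex_iff list_all_iff by blast
qed

definition poly_of :: "(int \<times> expt) list \<Rightarrow> (4, rat) mpoly" where
  "poly_of g = (\<Sum>(c, e)\<leftarrow>g. trm (of_int c) e)"

lemma poly_of_Cons [simp]: "poly_of ((c, e) # g) = trm (of_int c) e + poly_of g"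
  and poly_of_Nil [simp]: "poly_of [] = 0"
  by (simp_all add: poly_of_def)

lemma keys_poly_of: "Poly_Mapping.keys (poly_of g) \<subseteq> expo ` snd ` set g"
proof (induction g)
  case (Cons ce g)
  then show ?case
    using keys_add [of "trm (of_int (fst ce)) (snd ce)" "poly_of g"] by (cases ce) (auto split:
      if_splits)
qed simp

text \<open>The exchange for strings: since \<open>phi\<close> is multiplicative, one relation
  multiplied by all powers b^n yields the whole family of relations. A tail monomial m may lie on
  the line of p only below p; then b^n m is in \<open>R\<close> or equals b^i p with i < n, as the
  triangular shape demands. With \<open>u\<close> false a single monomial is exchanged. Cell lists
  are compared by \<open>covers\<close> before and after, so that strings can be split and
  merged.\<close>

lemma indep_step:
  assumes "indep (cells T)"
    and "phi (poly_of ((cp, p) # (cq, q) # \<rho>)) = 0"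
    and "list_all (covers T) ((p, u) # R)"
    and "cp \<noteq> 0 \<and> cq \<noteq> 0 \<and> list_all (\<lambda>(c, m). covers ((p, u) # R) (m, u) \<and> \<not> in_string m (p, u)) \<rho> \<and>
      list_all (apart (p, u)) R \<and> list_all (apart (q, u)) R"
    and "list_all (covers ((q, u) # R)) T'"
  shows "indep (cells T')"
proof -
  let ?J = "if u then UNIV else {0 :: nat}"
  let ?p = "\<lambda>n. p + (0, n, 0, 0)" and ?q = "\<lambda>n. q + (0, n, 0, 0)"
  have "indep (?q ` ?J \<union> cells R)"
  proof (rule indep_exchange [where p = ?p and cp = "of_int cp" and cq = "of_int cq"
        and \<rho> = "\<lambda>n. trm 1 (0, n, 0, 0) * poly_of \<rho>"])
    show "indep (?p ` ?J \<union> cells R)"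
      using indep_mono [OF assms(1) cells_mono [OF assms(3)]] by (simp add: cells_Cons)
    show "inj_on ?p ?J" "inj_on ?q ?J" by (auto simp: inj_on_def)
    show "?p ` ?J \<inter> cells R = {}" "?q ` ?J \<inter> cells R = {}"
      using assms(4) apart_cells by simp_all
    show "phi (trm (of_int cp) (?p n) + trm (of_int cq) (?q n) + trm 1 (0, n, 0, 0) * poly_of \<rho>) = 0"
      if "n \<in> ?J" for n
    proof -
      have "trm (of_int cp) (?p n) + trm (of_int cq) (?q n) + trm 1 (0, n, 0, 0) * poly_of \<rho>
          = trm 1 (0, n, 0, 0) * poly_of ((cp, p) # (cq, q) # \<rho>)"
        by (simp add: distrib_left trm_mult add_ac)
      then show ?thesis using assms(2) by (simp add: phi_mult)
    qed
    show "Poly_Mapping.keys (trm 1 (0, n, 0, 0) * poly_of \<rho>) \<subseteq> expo ` (cells R \<union> ?p ` {i \<in> ?J. i <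
      n})" if n: "n \<in> ?J" for n
    proof
      fix \<alpha> assume "\<alpha> \<in> Poly_Mapping.keys (trm 1 (0, n, 0, 0) * poly_of \<rho>)"
      then obtain c m where m: "(c, m) \<in> set \<rho>" "\<alpha> = expo (0, n, 0, 0) + expo m"
        using keys_single_mult [of "expo (0, n, 0, 0)" 1 "poly_of \<rho>"] keys_poly_of [of \<rho>] by fastforce
      then have "\<alpha> = expo (m + (0, n, 0, 0))"
        by (metis expo_add add.commute)
      moreover have "m + (0, n, 0, 0) \<in> cells R \<union> ?p ` {i \<in> ?J. i < n}"
      proof -
        have cov: "covers ((p, u) # R) (m, u)" and notin: "\<not> in_string m (p, u)"
          using assms(4) m(1) unfolding list_all_iff by fastforce+
        have "in_string (m + (0, n, 0, 0)) (m, u)"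
          using n unfolding in_string_iff by (auto split: if_splits)
        with cov have "m + (0, n, 0, 0) \<in> ?p ` ?J \<union> cells R"
          using coversD cells_Cons by blast
        moreover have "i < n" if "i \<in> ?J" "m + (0, n, 0, 0) = ?p i" for i
        proof (rule ccontr)
          \<comment> \<open>Otherwise m would be b^(i - n) p and belong to the string that is being
            removed.\<close>
          assume "\<not> i < n"
          then have "m = p + (0, i - n, 0, 0)"
            using that(2) by (cases m; cases p) auto
          moreover have "u \<or> i - n = 0" using that(1) by (auto split: if_splits)
          ultimately show False using notin in_string_iff by blast
        qed
        ultimately show ?thesis by blast
      qed
      ultimately show "\<alpha> \<in> expo ` (cells R \<union> ?p ` {i \<in> ?J. i < n})" by blast
    qed
  qed (use assms(4) in auto)
  then have "indep (cells ((q, u) # R))" by (simp add: cells_Cons)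
  then show ?thesis using cells_mono [OF assms(5)] by (rule indep_mono)
qed

section \<open>The ideal and its standard monomials\<close>

fun in_N :: "expt \<Rightarrow> bool" where
  "in_N (i, j, k, l) \<longleftrightarrow> 0 < k \<or> 0 < i \<and> (0 < j \<or> 2 \<le> l)"

lemma in_N_add: "in_N e \<Longrightarrow> in_N (e' + e)"
  by (cases e; cases e') auto

definition jensen_ideal :: "(4, rat) mpoly set" where
  "jensen_ideal = ideal_of {var 1 * var 3 * var 4 + var 1 ^ 2 * var 3 - var 1 * var 2,
     var 1 * var 4 ^ 2 - var 3, var 1 * var 4 ^ 4 + var 1 * var 3}"

definition vanishing_ideal :: "(4, rat) mpoly set" where
  "vanishing_ideal = {f. Poly_Mapping.keys f \<subseteq> expo ` Collect in_N \<and> phi f = 0}"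

lemma var_eq_trm:
  "var 1 = trm 1 (1, 0, 0, 0)" "var 2 = trm 1 (0, 1, 0, 0)"
  "var 3 = trm 1 (0, 0, 1, 0)" "var 4 = trm 1 (0, 0, 0, 1)"
  by (simp_all add: var_def expo.simps)

text \<open>A polynomial over the infinite field of rationals that vanishes at every point is zero.
  Relations thus become ring identities in one number t, with the image of b factored as t^5 (t -
  1).\<close>

lemma phi_poly_of_0:
  assumes "\<And>t :: rat. (\<Sum>(c, i, j, k, l)\<leftarrow>g. of_int c * ((-1) ^ (i + k) * (t ^ (2 * i + 5 * j + 4 * k +
    l) * (t - 1) ^ j))) = 0"
  shows "phi (poly_of g) = 0"
proof -
  have "poly (phi (poly_of g)) t = (\<Sum>(c, i, j, k, l)\<leftarrow>g. of_int c * ((-1) ^ (i + k) * (t ^ (2 * i + 5 *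
    j + 4 * k + l) * (t - 1) ^ j)))" for t
  proof (induction g)
    case (Cons a g)
    obtain c i j k l where a: "a = (c, i, j, k, l)" by (metis prod_cases5)
    show ?case
      using Cons by (simp add: a phi_add phi_single ev_expo poly_monom)
  qed simp
  then have "\<forall>t. poly (phi (poly_of g)) t = 0"
    using assms by simp
  then show ?thesis
    by (simp only: poly_all_0_iff_0)
qed

lemma poly_of_in_vanishing_ideal:
  assumes "list_all (\<lambda>(c, m). in_N m) g" "phi (poly_of g) = 0"
  shows "poly_of g \<in> vanishing_ideal"
  using assms by (auto simp: vanishing_ideal_def list_all_iff dest!: subsetD [OF keys_poly_of])

lemma vanishing_ideal_add: "f \<in> vanishing_ideal \<Longrightarrow> g \<in> vanishing_ideal \<Longrightarrow> f + g \<in> vanishing_ideal"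
  using keys_add [of f g] by (auto simp: vanishing_ideal_def phi_add)

lemma vanishing_ideal_mult: assumes "f \<in> vanishing_ideal" shows "q * f \<in> vanishing_ideal"
proof -
  have "Poly_Mapping.keys (q * f) \<subseteq> expo ` Collect in_N"
  proof
    fix \<alpha> assume "\<alpha> \<in> Poly_Mapping.keys (q * f)"
    then obtain \<beta> \<gamma> where "\<alpha> = \<beta> + \<gamma>" "\<gamma> \<in> Poly_Mapping.keys f"
      using keys_mult [of q f] by blast
    moreover obtain e where "\<beta> = expo e" by (rule expo_cases)
    moreover obtain e' where "\<gamma> = expo e'" "in_N e'"
      using \<open>\<gamma> \<in> _\<close> assms by (auto simp: vanishing_ideal_def)
    ultimately show "\<alpha> \<in> expo ` Collect in_N"
      by (metis expo_add in_N_add imageI mem_Collect_eq)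
  qed
  then show ?thesis using assms by (simp add: vanishing_ideal_def phi_mult)
qed

lemma generators_eq_poly_of:
  "var 1 * var 3 * var 4 + var 1 ^ 2 * var 3 - var 1 * var 2
     = poly_of [(1, (1, 0, 1, 1)), (1, (2, 0, 1, 0)), (-1, (1, 1, 0, 0))]"
  "var 1 * var 4 ^ 2 - var 3 = poly_of [(1, (1, 0, 0, 2)), (-1, (0, 0, 1, 0))]"
  "var 1 * var 4 ^ 4 + var 1 * var 3 = poly_of [(1, (1, 0, 0, 4)), (1, (1, 0, 1, 0))]"
  by (simp_all add: var_eq_trm trm_mult eval_nat_numeral single_uminus)

text \<open>Both N and the kernel of \<open>phi\<close> are ideals, so it suffices to check the
  three generators.\<close>

lemma jensen_ideal_subset_vanishing_ideal: "jensen_ideal \<subseteq> vanishing_ideal"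
  unfolding jensen_ideal_def generators_eq_poly_of
proof (rule ideal_of_least)
  show "{poly_of [(1, (1, 0, 1, 1)), (1, (2, 0, 1, 0)), (-1, (1, 1, 0, 0))],
      poly_of [(1, (1, 0, 0, 2)), (-1, (0, 0, 1, 0))], poly_of [(1, (1, 0, 0, 4)),
        (1, (1, 0, 1, 0))]} \<subseteq> vanishing_ideal"
    by (simp del: poly_of_Cons, intro conjI poly_of_in_vanishing_ideal phi_poly_of_0; simp; algebra)
qed (auto simp: vanishing_ideal_add vanishing_ideal_mult, simp add: vanishing_ideal_def)

lemma expt_le_obtain:
  assumes "(l :: expt) \<le> m"
  obtains s where "m = s + l"
proof -
  obtain i j k n where l: "l = (i, j, k, n)" by (metis prod_cases4)
  obtain i' j' k' n' where m: "m = (i', j', k', n')" by (metis prod_cases4)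
  have "m = (i' - i, j' - j, k' - k, n' - n) + l"
    using assms by (simp add: l m)
  then show thesis by (rule that)
qed

section \<open>A finite certificate that leading monomials and cells exhaust N\<close>

definition reached :: "expt list \<Rightarrow> (expt \<times> bool) list \<Rightarrow> expt \<Rightarrow> bool" where
  "reached L T m \<longleftrightarrow> list_ex (\<lambda>l. l \<le> m) L \<or> list_ex (in_string m) T"

text \<open>For an infinite string the test is again finite: from b-exponent j' on, a member of
  \<open>L\<close> divides everything or a string of \<open>T\<close> takes over.\<close>

fun covered :: "expt list \<Rightarrow> (expt \<times> bool) list \<Rightarrow> expt \<times> bool \<Rightarrow> bool" where
  "covered L T ((i, j, k, l), u) \<longleftrightarrow>
     (if u then
        list_ex (\<lambda>(i', j', k', l'). i' \<le> i \<and> k' \<le> k \<and> l' \<le> l \<and>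
          list_all (\<lambda>n. reached L T (i, n, k, l)) [j..<j']) L \<or>
        list_ex (\<lambda>((i', j', k', l'), u). u \<and> i = i' \<and> k = k' \<and> l = l' \<and>
          list_all (\<lambda>n. reached L T (i, n, k, l)) [j..<j']) T
      else reached L T (i, j, k, l))"

lemma coveredD:
  assumes "covered L T (e, u)" "in_string m (e, u)"
  shows "reached L T m"
proof -
  obtain i j k l where e: "e = (i, j, k, l)" by (metis prod_cases4)
  obtain n where n: "u \<or> n = 0" "m = (i, j + n, k, l)"
    using assms(2) by (auto simp: in_string_iff e)
  show ?thesis
  proof (cases u)
    case False
    then show ?thesis using assms(1) n e by simp
  next
    case True
    then obtain j' where j': "\<forall>n\<in>{j..<j'}. reached L T (i, n, k, l)"
      and "(\<exists>i' k' l'. (i', j', k', l') \<in> set L \<and> i' \<le> i \<and> k' \<le> k \<and> l' \<le> l) \<or> ((i, j', k, l), True) \<in>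
        set T"
      using assms(1) unfolding e by (auto simp: list_ex_iff list_all_iff)
    from this(2) have "reached L T (i, n, k, l)" if "j' \<le> n" for n
      using that by (fastforce simp: reached_def list_ex_iff)
    then show ?thesis using j' n(2) by (cases "j + n < j'") auto
  qed
qed

text \<open>Local closure conditions, starting from the three generators of N. Multiplication by b
  stays inside an infinite string, hence the separate clause for single monomials.\<close>

definition covering :: "expt list \<Rightarrow> (expt \<times> bool) list \<Rightarrow> bool" where
  "covering L T \<longleftrightarrow>
     list_all (reached L T) [(0, 0, 1, 0), (1, 1, 0, 0), (1, 0, 0, 2)] \<and>
     list_all (\<lambda>s. list_all (\<lambda>d. covered L T (fst s + d, snd s)) [(1, 0, 0, 0), (0, 0, 1, 0), (0, 0,
       0, 1)] \<and>
       (snd s \<or> reached L T (fst s + (0, 1, 0, 0)))) T"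

text \<open>The reached monomials contain the generators of N and are closed under multiplication by
  each variable: a multiple of a member of \<open>L\<close> remains one, and for cells
  \<open>covering\<close> records the check. So they include every monomial of N.\<close>

lemma covering_in_N:
  assumes cov: "covering L T" and m: "in_N m"
  shows "(\<exists>l\<in>set L. l \<le> m) \<or> m \<in> cells T"
proof -
  define X where "X = {m. reached L T m}"
  have step: "m + d \<in> X" if "m \<in> X" and d: "d \<in> {(1, 0, 0, 0), (0, 1, 0, 0), (0, 0, 1, 0), (0, 0, 0,
    1)}" for m d
  proof (cases "list_ex (\<lambda>l. l \<le> m) L")
    case True
    have "m \<le> m + d" by (cases m; cases d) simp
    then have "list_ex (\<lambda>l. l \<le> m + d) L"
      using True unfolding list_ex_iff by (blast intro: order_trans)
    then show ?thesis by (simp add: X_def reached_def)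
  next
    case False
    then obtain e u where e: "(e, u) \<in> set T" "in_string m (e, u)"
      using \<open>m \<in> X\<close> by (auto simp: X_def reached_def list_ex_iff)
    then obtain n where n: "u \<or> n = 0" "m = e + (0, n, 0, 0)" by (auto simp: in_string_iff)
    have cT: "list_all (\<lambda>d. covered L T (e + d, u)) [(1, 0, 0, 0), (0, 0, 1, 0), (0, 0, 0, 1)]"
       "u \<or> reached L T (e + (0, 1, 0, 0))"
      using cov e(1) unfolding covering_def list_all_iff [of _ T] by fastforce+
    show ?thesis
    proof (cases "d = (0, 1, 0, 0)")
      case True
      show ?thesis
      proof (cases u)
        case True
        have "in_string (m + d) (e, u)"
          using n True \<open>d = _\<close> unfolding in_string_iff by (intro exI [of _ "Suc n"]) (simp add:
            add.assoc)
        then show ?thesis using e by (auto simp: X_def reached_def list_ex_iff)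
      next
        case False
        then have "m + d = e + (0, 1, 0, 0)" using n \<open>d = _\<close> by (simp add: zero_prod_def [symmetric])
        then show ?thesis using cT(2) False by (simp add: X_def)
      qed
    next
      case False
      then have "covered L T (e + d, u)" using cT(1) d by auto
      moreover have "m + d = e + d + (0, n, 0, 0)" using n by (simp add: add_ac)
      then have "in_string (m + d) (e + d, u)" unfolding in_string_iff using n by blast
      ultimately show ?thesis by (simp add: X_def coveredD)
    qed
  qed
  have "m + (i, j, k, l) \<in> X" if "m \<in> X" for m i j k l
  proof -
    have a: "m + (i, 0, 0, 0) \<in> X" if "m \<in> X" for m i
    proof (induction i)
      case (Suc i) show ?case using step [OF Suc, of "(1, 0, 0, 0)"] by (simp add: add.assoc)
    qed (simp add: that flip: zero_prod_def)
    have b: "m + (0, j, 0, 0) \<in> X" if "m \<in> X" for m j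
    proof (induction j)
      case (Suc i) show ?case using step [OF Suc, of "(0, 1, 0, 0)"] by (simp add: add.assoc)
    qed (simp add: that flip: zero_prod_def)
    have c: "m + (0, 0, k, 0) \<in> X" if "m \<in> X" for m k
    proof (induction k)
      case (Suc i) show ?case using step [OF Suc, of "(0, 0, 1, 0)"] by (simp add: add.assoc)
    qed (simp add: that flip: zero_prod_def)
    have d: "m + (0, 0, 0, l) \<in> X" if "m \<in> X" for m l
    proof (induction l)
      case (Suc i) show ?case using step [OF Suc, of "(0, 0, 0, 1)"] by (simp add: add.assoc)
    qed (simp add: that flip: zero_prod_def)
    show ?thesis using d [OF c [OF b [OF a [OF that]]], of i j k l] by (simp add: add.assoc)
  qed
  then have up: "m \<in> X" if "e \<in> X" "e \<le> m" for e m
    using that(1) by (rule_tac expt_le_obtain [OF that(2)]) (metis add.commute prod_cases4)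
  have "(0, 0, 1, 0) \<in> X" "(1, 1, 0, 0) \<in> X" "(1, 0, 0, 2) \<in> X"
    using cov by (auto simp: covering_def X_def)
  then have "m \<in> X"
    using m up by (cases m) (auto simp: Suc_le_eq)
  then show ?thesis by (auto simp: X_def reached_def cells_def list_ex_iff)
qed

section \<open>Initial ideals\<close>

lemma lookup_initial_form:
  "Poly_Mapping.lookup (initial_form \<omega> f) \<alpha> =
     (if \<alpha> \<in> Poly_Mapping.keys f \<and> (\<forall>\<beta>\<in>Poly_Mapping.keys f. exponent \<beta> \<bullet> \<omega> \<le> exponent \<alpha> \<bullet> \<omega>)
      then Poly_Mapping.lookup f \<alpha> else 0)"
proof -
  let ?A = "{\<alpha> \<in> Poly_Mapping.keys f. \<forall>\<beta>\<in>Poly_Mapping.keys f. exponent \<beta> \<bullet> \<omega> \<le> exponent \<alpha> \<bullet> \<omega>}"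
  have "Poly_Mapping.lookup (initial_form \<omega> f) \<alpha> = (\<Sum>\<beta>\<in>?A. if \<beta> = \<alpha> then Poly_Mapping.lookup f \<alpha> else
    0)"
    unfolding initial_form_def lookup_sum by (intro sum.cong) (auto simp: lookup_single)
  then show ?thesis by auto
qed

lemma keys_initial_form:
  "Poly_Mapping.keys (initial_form \<omega> f)
     = {\<alpha> \<in> Poly_Mapping.keys f. \<forall>\<beta>\<in>Poly_Mapping.keys f. exponent \<beta> \<bullet> \<omega> \<le> exponent \<alpha> \<bullet> \<omega>}"
  by (auto simp: in_keys_iff lookup_initial_form split: if_splits)

lemma initial_form_nonzero:
  assumes "f \<noteq> 0"
  shows "initial_form \<omega> f \<noteq> 0"
proof -
  have ne: "Poly_Mapping.keys f \<noteq> {}" using assms by simp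
  let ?W = "(\<lambda>\<alpha>. exponent \<alpha> \<bullet> \<omega>) ` Poly_Mapping.keys f"
  have "Max ?W \<in> ?W" using ne by (intro Max_in) auto
  then obtain \<alpha> where \<alpha>: "\<alpha> \<in> Poly_Mapping.keys f" "exponent \<alpha> \<bullet> \<omega> = Max ?W" by auto
  then have "\<alpha> \<in> Poly_Mapping.keys (initial_form \<omega> f)"
    unfolding keys_initial_form by auto
  then show ?thesis by auto
qed

section \<open>Real weights of monomials\<close>

definition wt :: "real ^ 4 \<Rightarrow> expt \<Rightarrow> real" where
  "wt x e = exponent (expo e) \<bullet> x"

lemma wt_simps: "wt x (i, j, k, l) = i * x $ 1 + j * x $ 2 + k * x $ 3 + l * x $ 4"
  by (simp add: wt_def exponent_def inner_vec_def sum_4)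

lemma wt_add: "wt x (e + e') = wt x e + wt x e'"
  by (cases e; cases e') (simp add: wt_simps algebra_simps)

lemma continuous_wt: "continuous_on UNIV (\<lambda>x. wt x e)"
  unfolding wt_def by (intro continuous_intros)

lemma finite_wt_less:
  assumes x: "\<And>i. 0 < x $ i"
  shows "finite {e. wt x e < w}"
proof -
  define n where "n i = nat \<lceil>w / x $ i\<rceil>" for i
  have n: "k \<le> n i" if "k * x $ i < w" for k :: nat and i
  proof -
    have "real k < w / x $ i" using that x [of i] by (simp add: field_simps)
    then show ?thesis unfolding n_def by linarith
  qed
  have "{e. wt x e < w} \<subseteq> {..n 1} \<times> {..n 2} \<times> {..n 3} \<times> {..n 4}"
  proof
    fix e assume "e \<in> {e. wt x e < w}"
    then obtain i j k l where e: "e = (i, j, k, l)" and w: "i * x $ 1 + j * x $ 2 + k * x $ 3 + l * x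
      $ 4 < w"
      by (cases e) (auto simp: wt_simps)
    have "0 \<le> i * x $ 1" "0 \<le> j * x $ 2" "0 \<le> k * x $ 3" "0 \<le> l * x $ 4"
      using x by (simp_all add: less_imp_le)
    then have "i * x $ 1 < w" "j * x $ 2 < w" "k * x $ 3 < w" "l * x $ 4 < w" using w by linarith+
    then show "e \<in> {..n 1} \<times> {..n 2} \<times> {..n 3} \<times> {..n 4}"
      unfolding e using n by auto
  qed
  then show ?thesis by (rule finite_subset) auto
qed

text \<open>Real numbers are not well ordered, but under a positive weight vector only finitely many
  monomials lie below a given weight. Their number is the measure.\<close>

lemma wt_induct [consumes 1, case_names less]:
  assumes x: "\<And>i. 0 < x $ i" and step: "\<And>m. (\<And>e. wt x e < wt x m \<Longrightarrow> P e) \<Longrightarrow> P m"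
  shows "P m"
proof (induction "card {e. wt x e < wt x m}" arbitrary: m rule: less_induct)
  case less
  show ?case
  proof (rule step)
    fix e assume "wt x e < wt x m"
    then have "{e'. wt x e' < wt x e} \<subset> {e'. wt x e' < wt x m}" by auto
    then show "P e" by (intro less psubset_card_mono finite_wt_less x)
  qed
qed

definition monomial_ideal :: "expt list \<Rightarrow> (4, rat) mpoly set" where
  "monomial_ideal L = ideal_of {trm 1 l |l. l \<in> set L}"

text \<open>The polynomials all of whose monomials are divisible by members of \<open>L\<close> form
  an ideal that contains the generators.\<close>

lemma keys_monomial_ideal:
  assumes "f \<in> monomial_ideal L" "expo e \<in> Poly_Mapping.keys f"
  shows "\<exists>l\<in>set L. l \<le> e"
proof -
  let ?K = "{f :: (4, rat) mpoly. \<forall>e. expo e \<in> Poly_Mapping.keys f \<longrightarrow> (\<exists>l\<in>set L. l \<le> e)}"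
  have "monomial_ideal L \<subseteq> ?K"
    unfolding monomial_ideal_def
  proof (rule ideal_of_least)
    fix q f assume f: "f \<in> ?K"
    show "q * f \<in> ?K"
    proof safe
      fix i j k l assume "expo (i, j, k, l) \<in> Poly_Mapping.keys (q * f)"
      then obtain \<beta> \<gamma> where bc: "expo (i, j, k, l) = \<beta> + \<gamma>" "\<gamma> \<in> Poly_Mapping.keys f"
        using keys_mult [of q f] by blast
      obtain e1 where e1: "\<beta> = expo e1" by (rule expo_cases)
      obtain e2 where e2: "\<gamma> = expo e2" by (rule expo_cases)
      have "e2 \<le> (i, j, k, l)"
        using bc e1 e2 by (cases e1; cases e2) (simp flip: expo_add)
      then show "\<exists>m\<in>set L. m \<le> (i, j, k, l)"
        using f bc(2) e2 by (blast intro: order_trans)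
    qed
  qed (use keys_add in \<open>fastforce split: if_splits\<close>)+
  then show ?thesis using assms by blast
qed

section \<open>Groebner bases from spanning and independence\<close>

definition tops :: "(int \<times> expt) list list \<Rightarrow> expt list" where
  "tops G = map (snd \<circ> hd) G"

definition dominant :: "(int \<times> expt) list list \<Rightarrow> real ^ 4 \<Rightarrow> bool" where
  "dominant G x \<longleftrightarrow> (\<forall>i. 0 < x $ i) \<and> (\<forall>g\<in>set G. \<forall>(c, m)\<in>set (tl g). wt x m < wt x (snd (hd g)))"

text \<open>A criterion without S-polynomials. By \<open>cover\<close>, division by \<open>G\<close>
  expresses everything in N through the cells of \<open>T\<close>; by \<open>indep_T\<close>, this
  expression is unique modulo the ideal. No weight occurs in the assumptions, so one instance serves
  all weights satisfying \<open>dominant G\<close>.\<close>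

locale groebner =
  fixes G :: "(int \<times> expt) list list" and T :: "(expt \<times> bool) list"
  assumes G_ideal: "g \<in> set G \<Longrightarrow> poly_of g \<in> jensen_ideal"
    and G_top: "g \<in> set G \<Longrightarrow> g \<noteq> [] \<and> fst (hd g) \<noteq> 0"
    and cover: "covering (tops G) T"
    and indep_T: "indep (cells T)"
begin

text \<open>A normal form of the monomial m. The strict drop of weight for m outside the cells is
  what later leaves the coefficient of a cell of top weight untouched.\<close>

definition reduct :: "real ^ 4 \<Rightarrow> expt \<Rightarrow> (4, rat) mpoly \<Rightarrow> bool" where
  "reduct x m r \<longleftrightarrow> Poly_Mapping.keys r \<subseteq> expo ` cells T \<and> trm 1 m - r \<in> jensen_ideal \<and>
     (m \<in> cells T \<longrightarrow> r = trm 1 m) \<and>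
     (m \<notin> cells T \<longrightarrow> (\<forall>e. expo e \<in> Poly_Mapping.keys r \<longrightarrow> wt x e < wt x m))"

definition reduct_sum :: "(4, rat) mpoly \<Rightarrow> ((4 \<Rightarrow>\<^sub>0 nat) \<Rightarrow> (4, rat) mpoly) \<Rightarrow> (4, rat) mpoly" where
  "reduct_sum f \<rho> =
     (\<Sum>\<alpha>\<in>Poly_Mapping.keys f. Poly_Mapping.single 0 (Poly_Mapping.lookup f \<alpha>) * \<rho> \<alpha>)"

lemma keys_reduct_sum:
  assumes "\<beta> \<in> Poly_Mapping.keys (reduct_sum f \<rho>)"
  shows "\<exists>\<alpha>\<in>Poly_Mapping.keys f. \<beta> \<in> Poly_Mapping.keys (\<rho> \<alpha>)"
proof -
  obtain \<alpha> where \<alpha>: "\<alpha> \<in> Poly_Mapping.keys f"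
      "\<beta> \<in> Poly_Mapping.keys (Poly_Mapping.single 0 (Poly_Mapping.lookup f \<alpha>) * \<rho> \<alpha>)"
    using subsetD [OF keys_sum assms [unfolded reduct_sum_def]] by blast
  then show ?thesis using keys_single_mult [of 0 "Poly_Mapping.lookup f \<alpha>" "\<rho> \<alpha>"] by auto
qed

lemma reduct_sum:
  assumes \<rho>: "\<And>m. expo m \<in> Poly_Mapping.keys f \<Longrightarrow> reduct x m (\<rho> (expo m))"
  shows "f - reduct_sum f \<rho> \<in> jensen_ideal"
    and "Poly_Mapping.keys (reduct_sum f \<rho>) \<subseteq> expo ` cells T"
proof -
  have one: "Poly_Mapping.single \<alpha> 1 - \<rho> \<alpha> \<in> jensen_ideal \<and> Poly_Mapping.keys (\<rho> \<alpha>) \<subseteq> expo ` cells T"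
    if \<alpha>: "\<alpha> \<in> Poly_Mapping.keys f" for \<alpha>
  proof -
    obtain m where m: "\<alpha> = expo m" by (rule expo_cases)
    show ?thesis using \<rho> [of m] \<alpha> unfolding m reduct_def by blast
  qed
  have "(\<Sum>\<alpha>\<in>Poly_Mapping.keys f. Poly_Mapping.single 0 (Poly_Mapping.lookup f \<alpha>) *
      (Poly_Mapping.single \<alpha> 1 - \<rho> \<alpha>)) \<in> jensen_ideal"
    unfolding jensen_ideal_def
    by (intro ideal_of_sum ideal_of_mult) (simp add: one flip: jensen_ideal_def)
  then show "f - reduct_sum f \<rho> \<in> jensen_ideal"
    by (simp add: right_diff_distrib sum_subtractf mult_single poly_mapping_sum_single reduct_sum_def)
  show "Poly_Mapping.keys (reduct_sum f \<rho>) \<subseteq> expo ` cells T"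
    using one by (blast dest: keys_reduct_sum)
qed

text \<open>Division as an induction on weight: a monomial that is not a cell is a multiple of a
  leading monomial, and subtracting the matching multiple of a basis element leaves monomials of
  smaller weight.\<close>

lemma reduction:
  assumes x: "dominant G x" and "in_N m"
  shows "\<exists>r. reduct x m r"
proof -
  have pos: "0 < x $ i" for i using x by (simp add: dominant_def)
  show ?thesis
    using pos assms(2)
  proof (induction m rule: wt_induct)
    case (less m)
    show ?case
    proof (cases "m \<in> cells T")
      case True
      then have "reduct x m (trm 1 m)" by (auto simp: reduct_def jensen_ideal_def ideal_of_0)
      then show ?thesis ..
    next
      case False
      then obtain l where l: "l \<in> set (tops G)" "l \<le> m"
        using covering_in_N [OF cover less.prems] by auto
      then obtain g where g: "g \<in> set G" "l = snd (hd g)" by (auto simp: tops_def)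
      define c where "c = fst (hd g)"
      have g_eq: "g = (c, l) # tl g" and c0: "c \<noteq> 0"
        using G_top [OF g(1)] g(2) by (auto simp: c_def)
      obtain s where s: "m = s + l"
        using expt_le_obtain [OF l(2)] .
      define P where "P = trm (1 / of_int c) s * poly_of (tl g)"
      have "trm (1 / of_int c) s * poly_of g = trm 1 m + P"
        unfolding P_def by (subst g_eq) (simp add: distrib_left trm_mult s c0)
      then have mP: "trm 1 m + P \<in> jensen_ideal"
        using ideal_of_mult [OF G_ideal [OF g(1), unfolded jensen_ideal_def]] by (metis
          jensen_ideal_def)
      \<comment> \<open>Reduction must stay inside N, where \<open>covering_in_N\<close> applies.
        Both m and the ideal element are supported in N, hence so is their difference.\<close>
      have keys_P: "Poly_Mapping.keys P \<subseteq> expo ` Collect in_N"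
      proof -
        have "Poly_Mapping.keys (trm 1 m + P) \<subseteq> expo ` Collect in_N"
          using mP jensen_ideal_subset_vanishing_ideal by (auto simp: vanishing_ideal_def)
        moreover have "Poly_Mapping.keys P \<subseteq> insert (expo m) (Poly_Mapping.keys (trm 1 m + P))"
          using keys_diff [of "trm 1 m + P" "trm 1 m"] by auto
        ultimately show ?thesis using less.prems by auto
      qed
      have P_wt: "wt x e < wt x m" if e: "expo e \<in> Poly_Mapping.keys P" for e
      proof -
        obtain \<beta> where \<beta>: "\<beta> \<in> Poly_Mapping.keys (poly_of (tl g))" "expo e = expo s + \<beta>"
          using subsetD [OF keys_single_mult e [unfolded P_def]] by blast
        obtain d e' where "(d, e') \<in> set (tl g)" "expo e = expo s + expo e'"
          using subsetD [OF keys_poly_of \<beta>(1)] \<beta>(2) by auto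
        moreover from this(1) have "wt x e' < wt x l"
          using x g by (auto simp: dominant_def)
        ultimately show ?thesis by (simp add: s wt_add flip: expo_add)
      qed
      \<comment> \<open>Normal forms are indexed by exponent maps because \<open>reduct_sum\<close>
        runs over keys; \<open>expo\<close> is injective, so e is determined.\<close>
      define \<rho> where "\<rho> \<alpha> = (SOME r. \<exists>e. \<alpha> = expo e \<and> reduct x e r)" for \<alpha>
      have \<rho>: "reduct x e (\<rho> (expo e))" if e: "expo e \<in> Poly_Mapping.keys P" for e
      proof -
        have "in_N e" using subsetD [OF keys_P e] by (simp add: inj_image_mem_iff [OF inj_expo])
        then have "\<exists>r. reduct x e r" using less.IH P_wt [OF e] by blast
        then show ?thesis unfolding \<rho>_def by (auto intro: someI_ex)
      qed
      have "reduct x m (- reduct_sum P \<rho>)"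
        unfolding reduct_def
      proof (intro conjI impI allI)
        have neg: "Poly_Mapping.keys (- reduct_sum P \<rho>) = Poly_Mapping.keys (reduct_sum P \<rho>)"
          by (auto simp: in_keys_iff)
        show "Poly_Mapping.keys (- reduct_sum P \<rho>) \<subseteq> expo ` cells T"
          unfolding neg using reduct_sum(2) \<rho> .
        have "trm 1 m + P - (P - reduct_sum P \<rho>) \<in> jensen_ideal"
          using mP reduct_sum(1) [OF \<rho>] unfolding jensen_ideal_def by (rule ideal_of_diff)
        then show "trm 1 m - - reduct_sum P \<rho> \<in> jensen_ideal" by simp
        show "- reduct_sum P \<rho> = trm 1 m" if "m \<in> cells T" using that False by blast
        show "wt x e < wt x m" if e: "expo e \<in> Poly_Mapping.keys (- reduct_sum P \<rho>)" for e
        proof -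
          obtain \<alpha> where \<alpha>: "\<alpha> \<in> Poly_Mapping.keys P" "expo e \<in> Poly_Mapping.keys (\<rho> \<alpha>)"
            using keys_reduct_sum e neg by blast
          obtain e' where e': "\<alpha> = expo e'" by (rule expo_cases)
          have red: "reduct x e' (\<rho> \<alpha>)" using \<rho> \<alpha>(1) e' by simp
          have "wt x e \<le> wt x e'"
          proof (cases "e' \<in> cells T")
            case True
            then have "\<rho> \<alpha> = trm 1 e'" using red unfolding reduct_def by blast
            then show ?thesis using \<alpha>(2) by (simp split: if_splits)
          next
            case False
            then have "wt x e < wt x e'" using red \<alpha>(2) unfolding reduct_def by blast
            then show ?thesis by simp
          qed
          then show ?thesis using P_wt [of e'] \<alpha>(1) e' by simp
        qed
      qed
      then show ?thesis ..
    qed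
  qed
qed

text \<open>The normal form of f differs from f by an element of the ideal, so \<open>phi\<close>
  kills it. Being supported on independent monomials, it is zero, and therefore f itself is in the
  ideal.\<close>

lemma normal_form:
  assumes x: "dominant G x" and f: "f \<in> vanishing_ideal"
  obtains \<rho> where "\<And>m. expo m \<in> Poly_Mapping.keys f \<Longrightarrow> reduct x m (\<rho> (expo m))"
    and "reduct_sum f \<rho> = 0" and "f \<in> jensen_ideal"
proof -
  define \<rho> where "\<rho> \<alpha> = (SOME r. \<exists>e. \<alpha> = expo e \<and> reduct x e r)" for \<alpha>
  have \<rho>: "reduct x m (\<rho> (expo m))" if m: "expo m \<in> Poly_Mapping.keys f" for m
  proof -
    have "in_N m" using f m by (auto simp: vanishing_ideal_def inj_image_mem_iff [OF inj_expo])
    then have "\<exists>r. reduct x m r" using reduction [OF x] by blast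
    then show ?thesis unfolding \<rho>_def by (auto intro: someI_ex)
  qed
  have fs: "f - reduct_sum f \<rho> \<in> jensen_ideal" using reduct_sum(1) \<rho> .
  then have "phi (f - reduct_sum f \<rho>) = 0" using jensen_ideal_subset_vanishing_ideal by (auto simp:
    vanishing_ideal_def)
  then have "phi (reduct_sum f \<rho>) = 0" using f by (simp add: phi_diff vanishing_ideal_def)
  with reduct_sum(2) [OF \<rho>] have s0: "reduct_sum f \<rho> = 0" by (rule indepD [OF indep_T])
  then have "f \<in> jensen_ideal" using fs by simp
  with \<rho> s0 show thesis by (rule that)
qed

text \<open>Otherwise m is a cell, and only m contributes to the coefficient of m in the normal form
  of f: other cells reduce to themselves, and the remaining monomials reduce to weights strictly
  below their own, hence below that of m. The normal form would then be nonzero.\<close>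

lemma top_of_ideal:
  assumes x: "dominant G x" and f: "f \<in> jensen_ideal"
    and m: "expo m \<in> Poly_Mapping.keys (initial_form x f)"
  shows "\<exists>l\<in>set (tops G). l \<le> m"
proof (rule ccontr)
  assume no: "\<not> (\<exists>l\<in>set (tops G). l \<le> m)"
  have fJ: "f \<in> vanishing_ideal" using f jensen_ideal_subset_vanishing_ideal by blast
  have mf: "expo m \<in> Poly_Mapping.keys f" and top: "\<And>e. expo e \<in> Poly_Mapping.keys f \<Longrightarrow> wt x e \<le> wt x m"
    using m by (auto simp: keys_initial_form wt_def)
  have "in_N m" using mf fJ by (auto simp: vanishing_ideal_def)
  then have mT: "m \<in> cells T" using covering_in_N [OF cover] no by blast
  obtain \<rho> where r: "\<And>m. expo m \<in> Poly_Mapping.keys f \<Longrightarrow> reduct x m (\<rho> (expo m))"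
    and s0: "reduct_sum f \<rho> = 0"
    by (rule normal_form [OF x fJ]) (erule (1) that)
  have "Poly_Mapping.lookup (Poly_Mapping.single 0 (Poly_Mapping.lookup f \<alpha>) * \<rho> \<alpha>) (expo m)
      = (if \<alpha> = expo m then Poly_Mapping.lookup f (expo m) else 0)" if a: "\<alpha> \<in> Poly_Mapping.keys f"
        for \<alpha>
  proof -
    obtain e where e: "\<alpha> = expo e" by (rule expo_cases)
    have "Poly_Mapping.lookup (\<rho> \<alpha>) (expo m) = (if \<alpha> = expo m then 1 else 0)"
    proof (cases "e \<in> cells T")
      case True
      then have "\<rho> \<alpha> = trm 1 e" using r [of e] a unfolding reduct_def e by blast
      then show ?thesis by (simp add: e lookup_single)
    next
      case False
      have "expo m \<notin> Poly_Mapping.keys (\<rho> \<alpha>)"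
      proof
        assume "expo m \<in> Poly_Mapping.keys (\<rho> \<alpha>)"
        then have "wt x m < wt x e" using r [of e] a False unfolding reduct_def e by blast
        then show False using top [of e] a e by simp
      qed
      moreover have "e \<noteq> m" using False mT by blast
      ultimately show ?thesis using e by (auto simp: in_keys_iff)
    qed
    then show ?thesis
      using lookup_single_mult [of 0 "Poly_Mapping.lookup f \<alpha>" "\<rho> \<alpha>" "expo m"] by auto
  qed
  then have "(\<Sum>\<alpha>\<in>Poly_Mapping.keys f. Poly_Mapping.lookup (Poly_Mapping.single 0 (Poly_Mapping.lookup
    f \<alpha>) * \<rho> \<alpha>) (expo m))
      = (\<Sum>\<alpha>\<in>Poly_Mapping.keys f. if \<alpha> = expo m then Poly_Mapping.lookup f (expo m) else 0)"
    by (rule sum.cong [OF refl])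
  then have "Poly_Mapping.lookup f (expo m) = 0"
    using mf s0 by (simp add: reduct_sum_def flip: lookup_sum)
  then show False using mf by (simp add: in_keys_iff)
qed

lemma initial_ideal_eq:
  assumes x: "dominant G x"
  shows "initial_ideal x jensen_ideal = monomial_ideal (tops G)"
proof
  show "initial_ideal x jensen_ideal \<subseteq> monomial_ideal (tops G)"
    unfolding initial_ideal_def
  proof (rule ideal_of_least)
    show "{initial_form x f |f. f \<in> jensen_ideal \<and> f \<noteq> 0} \<subseteq> monomial_ideal (tops G)"
    proof safe
      fix f assume f: "f \<in> jensen_ideal"
      let ?h = "initial_form x f"
      have "Poly_Mapping.single \<alpha> (Poly_Mapping.lookup ?h \<alpha>) \<in> monomial_ideal (tops G)" if "\<alpha> \<in>
        Poly_Mapping.keys ?h" for \<alpha>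
      proof -
        obtain m where m: "\<alpha> = expo m" by (rule expo_cases)
        then obtain l where l: "l \<in> set (tops G)" "l \<le> m" using top_of_ideal [OF x f] \<open>\<alpha> \<in> _\<close> by blast
        obtain s where s: "m = s + l"
          using expt_le_obtain [OF l(2)] .
        have "trm (Poly_Mapping.lookup ?h \<alpha>) s * trm 1 l \<in> monomial_ideal (tops G)"
          unfolding monomial_ideal_def using l(1) by (intro ideal_of_mult ideal_of_base) blast
        then show ?thesis by (simp add: trm_mult m s)
      qed
      then have "(\<Sum>\<alpha>\<in>Poly_Mapping.keys ?h. Poly_Mapping.single \<alpha> (Poly_Mapping.lookup ?h \<alpha>)) \<in>
        monomial_ideal (tops G)"
        unfolding monomial_ideal_def by (intro ideal_of_sum)
      then show "?h \<in> monomial_ideal (tops G)" by (simp add: poly_mapping_sum_single)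
    qed
  qed (auto simp: monomial_ideal_def ideal_of_0 intro: ideal_of_add ideal_of_mult)
  show "monomial_ideal (tops G) \<subseteq> initial_ideal x jensen_ideal"
    unfolding monomial_ideal_def
  proof (rule ideal_of_least)
    show "{trm 1 l |l. l \<in> set (tops G)} \<subseteq> initial_ideal x jensen_ideal"
    proof safe
      fix l assume "l \<in> set (tops G)"
      then obtain g where g: "g \<in> set G" "l = snd (hd g)" by (auto simp: tops_def)
      define c where "c = fst (hd g)"
      have g_eq: "g = (c, l) # tl g" and c0: "c \<noteq> 0"
        using G_top [OF g(1)] g(2) by (auto simp: c_def)
      have tail: "wt x e < wt x l" if "expo e \<in> Poly_Mapping.keys (poly_of (tl g))" for e
        using that keys_poly_of [of "tl g"] x g by (fastforce simp: dominant_def)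
      have tail_l: "Poly_Mapping.lookup (poly_of (tl g)) (expo l) = 0"
        using tail [of l] by (auto simp: in_keys_iff)
      have lg: "Poly_Mapping.lookup (poly_of g) (expo l) = of_int c"
        by (subst g_eq) (simp add: lookup_add tail_l)
      have keys_g: "e = l \<or> wt x e < wt x l" if "expo e \<in> Poly_Mapping.keys (poly_of g)" for e
      proof -
        have "poly_of g = trm (of_int c) l + poly_of (tl g)" by (subst g_eq) simp
        then have "expo e \<in> Poly_Mapping.keys (trm (of_int c :: rat) l) \<union> Poly_Mapping.keys (poly_of
          (tl g))"
          using that keys_add [of "trm (of_int c) l" "poly_of (tl g)"] by auto
        then show ?thesis using tail [of e] by (auto split: if_splits)
      qed
      \<comment> \<open>Dominance leaves only the first entry of the list in the initial form; its
        coefficient is a unit, so the ideal contains the bare monomial.\<close>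
      have "initial_form x (poly_of g) = trm (of_int c) l"
      proof (rule poly_mapping_eqI)
        fix \<alpha>
        obtain e where e: "\<alpha> = expo e" by (rule expo_cases)
        have lk: "expo l \<in> Poly_Mapping.keys (poly_of g)" using lg c0 by (simp add: in_keys_iff)
        have all: "\<forall>\<beta>\<in>Poly_Mapping.keys (poly_of g). exponent \<beta> \<bullet> x \<le> exponent (expo l) \<bullet> x"
        proof
          fix \<beta> assume b: "\<beta> \<in> Poly_Mapping.keys (poly_of g)"
          obtain e where "\<beta> = expo e" by (rule expo_cases)
          then show "exponent \<beta> \<bullet> x \<le> exponent (expo l) \<bullet> x" using keys_g [of e] b by (auto simp:
            wt_def)
        qed
        show "Poly_Mapping.lookup (initial_form x (poly_of g)) \<alpha> = Poly_Mapping.lookup (trm (of_int c)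
          l) \<alpha>"
        proof (cases "e = l")
          case True
          then show ?thesis using lk all by (simp add: lookup_initial_form e lg)
        next
          case False
          then have "\<not> (\<alpha> \<in> Poly_Mapping.keys (poly_of g) \<and> (\<forall>\<beta>\<in>Poly_Mapping.keys (poly_of g).
            exponent \<beta> \<bullet> x \<le> exponent \<alpha> \<bullet> x))"
            using keys_g [of e] lk e by (auto simp: wt_def not_le)
          then have "Poly_Mapping.lookup (initial_form x (poly_of g)) \<alpha> = 0"
            unfolding lookup_initial_form by (rule if_not_P)
          then show ?thesis using False by (simp add: e lookup_single)
        qed
      qed
      moreover have "poly_of g \<noteq> 0" using lg c0 by auto
      ultimately have "trm (of_int c) l \<in> initial_ideal x jensen_ideal"
        unfolding initial_ideal_def using G_ideal [OF g(1)] by (intro ideal_of_base) (metis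
          (mono_tags, lifting) mem_Collect_eq)
      then have "trm (1 / of_int c) 0 * trm (of_int c) l \<in> initial_ideal x jensen_ideal"
        unfolding initial_ideal_def by (rule ideal_of_mult)
      then show "trm 1 l \<in> initial_ideal x jensen_ideal" using c0 by (simp add: trm_mult)
    qed
  qed (auto simp: initial_ideal_def ideal_of_0 intro: ideal_of_add ideal_of_mult)
qed

end

section \<open>Normal cones and cones of the fan\<close>

lemma closure_add_scaleR:
  fixes u v :: "'a::real_normed_vector"
  assumes "\<And>\<epsilon>. 0 < \<epsilon> \<Longrightarrow> u + \<epsilon> *\<^sub>R v \<in> S"
  shows "u \<in> closure S"
proof -
  have "(\<lambda>n. u + inverse (real (Suc n)) *\<^sub>R v) \<longlonglongrightarrow> u + 0 *\<^sub>R v"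
    by (intro tendsto_intros LIMSEQ_inverse_real_of_nat)
  moreover have "\<forall>n. u + inverse (real (Suc n)) *\<^sub>R v \<in> S"
    using assms by simp
  ultimately show ?thesis
    unfolding closure_sequential by (intro exI [of _ "\<lambda>n. u + inverse (real (Suc n)) *\<^sub>R v"]) simp
qed

text \<open>The inequality holds for all weights with face \<open>F\<close> and defines a closed
  half-space, so it passes to the closure.\<close>

lemma normal_cone_max:
  assumes "p \<in> F" "u \<in> normal_cone P F" "q \<in> P"
  shows "u \<bullet> q \<le> u \<bullet> p"
proof -
  have "normal_cone P F \<subseteq> {u. u \<bullet> q \<le> u \<bullet> p}"
    unfolding normal_cone_def
    using assms by (intro closure_minimal closed_Collect_le continuous_intros) (auto simp: face_def)
  then show ?thesis using assms by blast
qed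

text \<open>If p maximizes both forms, then for all positive a and b the maximizers of a u + b w are
  exactly the common maximizers, one fixed face. Both u and w are limits of such combinations, so
  they lie in its normal cone.\<close>

lemma common_normal_cone:
  assumes p: "p \<in> face u P" "p \<in> face w P"
  obtains N where "N \<in> normal_fan P" "u \<in> N" "w \<in> N"
proof -
  have eq: "face (a *\<^sub>R u + b *\<^sub>R w) P = {q \<in> P. u \<bullet> q = u \<bullet> p \<and> w \<bullet> q = w \<bullet> p}" if "0 < a" "0 < b"
    for a b :: real
  proof -
    have le: "u \<bullet> q \<le> u \<bullet> p" "w \<bullet> q \<le> w \<bullet> p" if "q \<in> P" for q
      using p that by (auto simp: face_def)
    have P: "p \<in> P" using p by (simp add: face_def)
    show ?thesis
    proof (rule set_eqI)
      fix q
      have "u \<bullet> q = u \<bullet> p \<and> w \<bullet> q = w \<bullet> p" if q: "q \<in> P" and "a * (u \<bullet> p) + b * (w \<bullet> p) \<le> a * (u \<bullet> q)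
        + b * (w \<bullet> q)"
      proof -
        have "a * (u \<bullet> q) \<le> a * (u \<bullet> p)" "b * (w \<bullet> q) \<le> b * (w \<bullet> p)"
          using le [OF q] \<open>0 < a\<close> \<open>0 < b\<close> by simp_all
        then have "a * (u \<bullet> q) = a * (u \<bullet> p)" "b * (w \<bullet> q) = b * (w \<bullet> p)" using that by linarith+
        then show ?thesis using \<open>0 < a\<close> \<open>0 < b\<close> by simp
      qed
      moreover have "a * (u \<bullet> q) + b * (w \<bullet> q) \<le> a * (u \<bullet> p) + b * (w \<bullet> p)" if "q \<in> P" for q
        using le [OF that] \<open>0 < a\<close> \<open>0 < b\<close> by (intro add_mono mult_left_mono) auto
      ultimately show "q \<in> face (a *\<^sub>R u + b *\<^sub>R w) P \<longleftrightarrow> q \<in> {q \<in> P. u \<bullet> q = u \<bullet> p \<and> w \<bullet> q = w \<bullet> p}"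
        using P by (auto simp: face_def inner_add_left)
    qed
  qed
  define F where "F = face (1 *\<^sub>R u + 1 *\<^sub>R w) P"
  have F: "face (a *\<^sub>R u + b *\<^sub>R w) P = F" if "0 < a" "0 < b" for a b
    unfolding F_def using that by (simp only: eq zero_less_one)
  have "p \<in> F" using p unfolding F_def by (subst eq) (auto simp: face_def)
  then have "normal_cone P F \<in> normal_fan P"
    unfolding normal_fan_def nonempty_faces_def F_def by blast
  moreover have "u \<in> normal_cone P F" "w \<in> normal_cone P F"
    unfolding normal_cone_def
    using F [of 1] F [of _ 1] by (auto intro!: closure_add_scaleR [of u w] closure_add_scaleR [of w u]
      simp: add.commute)
  ultimately show thesis by (rule that)
qed

section \<open>Integer certificates for membership in cones\<close>

fun weight :: "expt \<Rightarrow> real ^ 4" where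
  "weight (i, j, k, l) = (\<chi> n. real (if n = 1 then i else if n = 2 then j else if n = 3 then k else l))"

fun dotp :: "expt \<Rightarrow> expt \<Rightarrow> nat" where
  "dotp (i, j, k, l) (i', j', k', l') = i * i' + j * j' + k * k' + l * l'"

lemma wt_weight: "wt (weight w) e = real (dotp e w)"
  by (cases w; cases e) (simp add: wt_simps)

lemma wt_add_left: "wt (x + y) e = wt x e + wt y e" and wt_scaleR: "wt (r *\<^sub>R x) e = r * wt x e"
  by (simp_all add: wt_def inner_add_right)

lemma inner_weight: "weight (i, j, k, l) \<bullet> p = i * p $ 1 + j * p $ 2 + k * p $ 3 + l * p $ 4"
  by (simp add: inner_vec_def sum_4)

lemma weight_nonneg: "0 \<le> weight u $ i"
  by (cases u) simp

fun positive :: "expt \<Rightarrow> bool" where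
  "positive (i, j, k, l) \<longleftrightarrow> 0 < i \<and> 0 < j \<and> 0 < k \<and> 0 < l"

lemma weight_pos: "positive v \<Longrightarrow> 0 < weight v $ i"
  by (cases v) simp

text \<open>With natural numbers as data, dominance is decided by rewriting. Positivity is demanded
  of interior vectors only; the rays tested by \<open>weakly\<close> may have zero
  coordinates.\<close>

definition strictly :: "(int \<times> expt) list list \<Rightarrow> expt \<Rightarrow> bool" where
  "strictly G v \<longleftrightarrow> positive v \<and> list_all (\<lambda>g. list_all (\<lambda>(c, m). dotp m v < dotp (snd (hd g)) v) (tl
    g)) G"

definition weakly :: "(int \<times> expt) list list \<Rightarrow> expt \<Rightarrow> bool" where
  "weakly G u \<longleftrightarrow> list_all (\<lambda>g. list_all (\<lambda>(c, m). dotp m u \<le> dotp (snd (hd g)) u) (tl g)) G"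

text \<open>A positive multiple of a strictly dominant vector turns all weak inequalities into
  strict ones and also makes every coordinate positive.\<close>

lemma dominant_ray:
  assumes "strictly G v" "weakly G u" "0 < \<epsilon>"
  shows "dominant G (weight u + \<epsilon> *\<^sub>R weight v)"
  unfolding dominant_def
proof (intro conjI allI ballI)
  show "0 < (weight u + \<epsilon> *\<^sub>R weight v) $ i" for i
    using assms weight_pos [of v i] weight_nonneg [of u i] by (simp add: strictly_def add_nonneg_pos)
next
  fix g cm assume g: "g \<in> set G" "cm \<in> set (tl g)"
  obtain c m where cm: "cm = (c, m)" by (rule prod.exhaust)
  have "dotp m u \<le> dotp (snd (hd g)) u" "dotp m v < dotp (snd (hd g)) v"
    using assms g cm by (auto simp: weakly_def strictly_def list_all_iff)
  then have "wt (weight u) m + \<epsilon> * wt (weight v) m < wt (weight u) (snd (hd g)) + \<epsilon> * wt (weight v)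
    (snd (hd g))"
    unfolding wt_weight using assms(3) by (intro add_le_less_mono mult_strict_left_mono) auto
  then show "case cm of (c, m) \<Rightarrow> wt (weight u + \<epsilon> *\<^sub>R weight v) m < wt (weight u + \<epsilon> *\<^sub>R weight v)
    (snd (hd g))"
    by (simp add: cm wt_add_left wt_scaleR)
qed

lemma dominant_strictly: "strictly G v \<Longrightarrow> dominant G (weight v)"
  using weight_pos by (auto simp: dominant_def strictly_def list_all_iff wt_weight)

lemma open_dominant: "open {x. dominant G x}"
proof -
  have "{x. dominant G x} = (\<Inter>i. {x. 0 < x $ i}) \<inter>
      (\<Inter>g\<in>set G. \<Inter>cm\<in>set (tl g). {x. wt x (snd cm) < wt x (snd (hd g))})"
    by (fastforce simp: dominant_def)
  moreover have "open {x :: real ^ 4. 0 < x $ i}" for i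
    by (intro open_Collect_less continuous_intros)
  moreover have "open {x. wt x e < wt x e'}" for e e'
    by (intro open_Collect_less continuous_wt)
  ultimately show ?thesis
    by (simp only:) (intro open_Int open_INT ballI finite_set finite_class.finite_UNIV; simp)
qed

lemma keys_poly_ofD: "expo m \<in> Poly_Mapping.keys (poly_of g) \<Longrightarrow> m \<in> snd ` set g"
  by (drule subsetD [OF keys_poly_of]) (simp only: inj_image_mem_iff [OF inj_expo])

lemma lookup_poly_of:
  assumes "distinct (map snd g)" "(c, m) \<in> set g"
  shows "Poly_Mapping.lookup (poly_of g) (expo m) = of_int c"
  using assms
proof (induction g)
  case (Cons a g)
  obtain c' m' where a: "a = (c', m')" by (rule prod.exhaust)
  show ?case
  proof (cases "m = m'")
    case True
    then have "expo m \<notin> Poly_Mapping.keys (poly_of g)"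
      using Cons.prems(1) keys_poly_ofD [of m g] by (auto simp: a)
    moreover have "(c, m) \<in> set g \<Longrightarrow> False" using True Cons.prems(1) by (force simp: a)
    ultimately show ?thesis using True Cons.prems(2) by (auto simp: a lookup_add in_keys_iff)
  next
    case False
    then show ?thesis using Cons by (auto simp: a lookup_add lookup_single)
  qed
qed simp

context groebner
begin

lemma ray_in_cone:
  assumes "strictly G v" "weakly G u"
  shows "weight u \<in> groebner_cone jensen_ideal (weight v)"
  unfolding groebner_cone_def
proof (rule closure_add_scaleR)
  fix \<epsilon> :: real assume "0 < \<epsilon>"
  then show "weight u + \<epsilon> *\<^sub>R weight v \<in> {x. initial_ideal x jensen_ideal = initial_ideal (weight v)
    jensen_ideal}"
    using initial_ideal_eq dominant_ray [OF assms] dominant_strictly [OF assms(1)] by simp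
qed

lemma cone_in_fan:
  assumes "strictly G v"
  shows "groebner_cone jensen_ideal (weight v) \<inter> nonneg_orthant \<in> restricted_groebner_fan jensen_ideal"
proof -
  have "\<forall>i. 0 < weight v $ i" using assms weight_pos by (simp add: strictly_def)
  then have "groebner_cone jensen_ideal (weight v) \<in> groebner_fan jensen_ideal"
    unfolding groebner_fan_def Let_def by blast
  then show ?thesis unfolding restricted_groebner_fan_def common_refinement_def by blast
qed

text \<open>A tail-reduced basis element g separates u from the cone of v. If both were in one cone,
  some weight y near u would have the initial ideal of v and yet prefer a tail monomial of g to its
  leading one. The initial form of g at y would lie in this monomial ideal although none of its
  monomials does.\<close>

lemma not_in_common_cone:
  assumes v: "strictly G v" and g: "g \<in> set G"
    and tails: "list_all (\<lambda>(c, m). list_all (\<lambda>l. \<not> l \<le> m) (tops G)) (tl g)"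
    and dist: "distinct (map snd g) \<and> list_all (\<lambda>(c, m). c \<noteq> 0) (tl g)"
    and u: "list_ex (\<lambda>(c, m). dotp (snd (hd g)) u < dotp m u) (tl g)"
    and C: "C \<in> restricted_groebner_fan jensen_ideal" "weight v \<in> C" "weight u \<in> C"
  shows False
proof -
  \<comment> \<open>Taking faces and intersections only shrinks a cone, so each member of the
    restricted fan lies in one full Groebner cone.\<close>
  obtain w where w: "weight v \<in> groebner_cone jensen_ideal w" "weight u \<in> groebner_cone jensen_ideal w"
    using C unfolding restricted_groebner_fan_def common_refinement_def groebner_fan_def Let_def
      nonempty_faces_def face_def by blast
  define S where "S = {x. initial_ideal x jensen_ideal = initial_ideal w jensen_ideal}"
  have cl: "weight v \<in> closure S" "weight u \<in> closure S" using w by (simp_all add: groebner_cone_def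
    S_def)
  have "weight v \<in> {x. dominant G x}" using dominant_strictly [OF v] by simp
  \<comment> \<open>The dominant weights form an open set around v, and v is in the closure of the
    class \<open>S\<close>; so \<open>S\<close> meets this set, which identifies its common initial
    ideal.\<close>
  then obtain x where "dominant G x" "x \<in> S"
    using cl(1) open_dominant by (metis (no_types, lifting) closure_iff_nhds_not_empty disjoint_iff
      mem_Collect_eq subset_refl)
  then have S: "initial_ideal y jensen_ideal = monomial_ideal (tops G)" if "y \<in> S" for y
    using initial_ideal_eq that by (simp add: S_def)
  obtain c m where m: "(c, m) \<in> set (tl g)" "dotp (snd (hd g)) u < dotp m u"
    using u by (auto simp: list_ex_iff)
  let ?l = "snd (hd g)"
  let ?U = "{x. wt x ?l < wt x m}"
  have "open ?U" by (intro open_Collect_less continuous_wt)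
  moreover have "weight u \<in> ?U" using m by (simp add: wt_weight)
  ultimately obtain y where y: "wt y ?l < wt y m" "y \<in> S"
    using cl(2) by (metis (no_types, lifting) closure_iff_nhds_not_empty disjoint_iff mem_Collect_eq
      subset_refl)
  have g_eq: "g = (fst (hd g), ?l) # tl g" using G_top [OF g] by simp
  have "(c, m) \<in> set g" using m(1) by (subst g_eq) simp
  then have "Poly_Mapping.lookup (poly_of g) (expo m) = of_int c"
    using dist by (intro lookup_poly_of) auto
  then have mg: "expo m \<in> Poly_Mapping.keys (poly_of g)"
    using dist m(1) by (auto simp: in_keys_iff list_all_iff)
  then have "poly_of g \<noteq> 0" by auto
  define h where "h = initial_form y (poly_of g)"
  have "h \<noteq> 0" unfolding h_def by (rule initial_form_nonzero) fact
  then obtain \<alpha> where \<alpha>: "\<alpha> \<in> Poly_Mapping.keys h" by fastforce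
  obtain e where e: "\<alpha> = expo e" by (rule expo_cases)
  have eg: "expo e \<in> Poly_Mapping.keys (poly_of g)" and top: "wt y m \<le> wt y e"
    using \<alpha> mg by (auto simp: h_def keys_initial_form e wt_def)
  have "h \<in> initial_ideal y jensen_ideal"
    unfolding initial_ideal_def h_def using \<open>poly_of g \<noteq> 0\<close> G_ideal [OF g] by (intro ideal_of_base)
      blast
  then have "\<exists>l\<in>set (tops G). l \<le> e"
    using S [OF y(2)] \<alpha> keys_monomial_ideal e by blast
  then have "e \<notin> snd ` set (tl g)" using tails unfolding list_all_iff by fastforce
  moreover have "e \<noteq> ?l" using top y(1) by auto
  moreover have "e \<in> snd ` set g" by (rule keys_poly_ofD [OF eg])
  then have "e = ?l \<or> e \<in> snd ` set (tl g)" by (subst (asm) g_eq) simp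
  ultimately show False by blast
qed

end

section \<open>Ten cones of the fan\<close>

text \<open>Each basis element is a list with its leading term first. The list \<open>Ti\<close> describes
  the monomials of \<open>N\<close> outside the initial ideal given by \<open>Gi\<close>.\<close>

definition G0 :: "(int \<times> expt) list list" where
  "G0 = [
    [(1, (0, 0, 1, 6)), (-1, (0, 0, 1, 5)), (-1, (0, 1, 1, 0))],
    [(1, (0, 0, 2, 0)), (1, (0, 0, 1, 4))],
    [(1, (1, 0, 0, 2)), (-1, (0, 0, 1, 0))],
    [(1, (1, 0, 1, 0)), (1, (0, 0, 1, 2))],
    [(1, (1, 1, 0, 0)), (1, (0, 0, 1, 3)), (-1, (0, 0, 1, 4))]]"

definition G1 :: "(int \<times> expt) list list" where
  "G1 = [
    [(1, (0, 0, 1, 2)), (1, (1, 0, 1, 0))],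
    [(1, (0, 0, 2, 1)), (-1, (0, 0, 2, 0)), (1, (1, 1, 0, 1))],
    [(1, (0, 0, 3, 0)), (1, (0, 0, 2, 0)), (-1, (0, 1, 1, 0)), (-1, (0, 1, 1, 1)), (-1, (1, 1, 0, 1)),
      (1, (1, 1, 1, 0))],
    [(1, (1, 0, 0, 2)), (-1, (0, 0, 1, 0))],
    [(1, (1, 0, 1, 1)), (-1, (0, 0, 2, 0)), (-1, (1, 1, 0, 0))],
    [(1, (1, 0, 2, 0)), (1, (0, 0, 2, 0)), (-1, (0, 1, 1, 0)), (-1, (1, 1, 0, 1))],
    [(1, (2, 0, 1, 0)), (1, (0, 0, 2, 0))],
    [(1, (2, 1, 0, 0)), (1, (0, 1, 1, 0))]]"

definition G2 :: "(int \<times> expt) list list" where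
  "G2 = [
    [(1, (0, 0, 1, 2)), (1, (1, 0, 1, 0))],
    [(1, (0, 0, 2, 1)), (1, (0, 0, 3, 0)), (-1, (0, 1, 1, 0)), (-1, (0, 1, 1, 1)), (1, (1, 1, 1, 0))],
    [(1, (0, 0, 4, 0)), (1, (0, 0, 3, 0)), (-2, (0, 1, 2, 0)), (2, (0, 1, 3, 0)), (-1, (0, 2, 1, 0)),
      (-2, (0, 2, 1, 1)), (-1, (1, 2, 0, 0)), (2, (1, 2, 1, 0))],
    [(1, (1, 0, 0, 2)), (-1, (0, 0, 1, 0))],
    [(1, (1, 0, 1, 1)), (-1, (0, 0, 2, 0)), (-1, (1, 1, 0, 0))],
    [(1, (1, 0, 2, 0)), (-1, (0, 0, 3, 0)), (1, (0, 1, 1, 1)), (-1, (1, 1, 1, 0))],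
    [(1, (1, 1, 0, 1)), (-1, (0, 0, 2, 0)), (-1, (0, 0, 3, 0)), (1, (0, 1, 1, 0)), (1, (0, 1, 1, 1)),
      (-1, (1, 1, 1, 0))],
    [(1, (2, 0, 1, 0)), (1, (0, 0, 2, 0))],
    [(1, (2, 1, 0, 0)), (1, (0, 1, 1, 0))]]"

definition G3 :: "(int \<times> expt) list list" where
  "G3 = [
    [(1, (0, 0, 1, 2)), (1, (1, 0, 1, 0))],
    [(1, (0, 0, 2, 1)), (1, (0, 0, 3, 0)), (-1, (0, 1, 1, 0)), (-1, (0, 1, 1, 1)), (1, (1, 1, 1, 0))],
    [(1, (0, 0, 5, 0)), (1, (0, 0, 4, 0)), (-4, (0, 1, 3, 0)), (3, (0, 2, 2, 0)), (-1, (1, 2, 1, 0)),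
      (2, (1, 3, 0, 0))],
    [(2, (0, 2, 1, 1)), (-1, (0, 0, 3, 0)), (-1, (0, 0, 4, 0)), (2, (0, 1, 2, 0)), (-2, (0, 1, 3, 0)),
      (1, (0, 2, 1, 0)), (1, (1, 2, 0, 0)), (-2, (1, 2, 1, 0))],
    [(1, (1, 0, 0, 2)), (-1, (0, 0, 1, 0))],
    [(1, (1, 0, 1, 1)), (-1, (0, 0, 2, 0)), (-1, (1, 1, 0, 0))],
    [(1, (1, 0, 2, 0)), (-1, (0, 0, 3, 0)), (1, (0, 1, 1, 1)), (-1, (1, 1, 1, 0))],
    [(1, (1, 1, 0, 1)), (-1, (0, 0, 2, 0)), (-1, (0, 0, 3, 0)), (1, (0, 1, 1, 0)), (1, (0, 1, 1, 1)),
      (-1, (1, 1, 1, 0))],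
    [(1, (2, 0, 1, 0)), (1, (0, 0, 2, 0))],
    [(1, (2, 1, 0, 0)), (1, (0, 1, 1, 0))]]"

definition G4 :: "(int \<times> expt) list list" where
  "G4 = [
    [(1, (0, 0, 1, 2)), (1, (1, 0, 1, 0))],
    [(1, (0, 0, 3, 1)), (-1, (0, 0, 3, 0)), (1, (0, 1, 2, 0)), (1, (1, 2, 0, 0))],
    [(2, (0, 0, 5, 0)), (1, (0, 0, 3, 0)), (3, (0, 0, 4, 0)), (-2, (0, 1, 2, 0)), (-6, (0, 1, 3, 0)),
      (-1, (0, 2, 1, 0)), (-2, (0, 2, 1, 1)), (6, (0, 2, 2, 0)), (-1, (1, 2, 0, 0)), (4, (1, 3, 0, 0))],
    [(2, (0, 1, 2, 1)), (-1, (0, 0, 3, 0)), (-1, (0, 0, 4, 0)), (2, (0, 1, 2, 0)), (-1, (0, 2, 1, 0)),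
      (1, (1, 2, 0, 0))],
    [(1, (1, 0, 0, 2)), (-1, (0, 0, 1, 0))],
    [(1, (1, 0, 1, 1)), (-1, (0, 0, 2, 0)), (-1, (1, 1, 0, 0))],
    [(1, (1, 0, 2, 0)), (1, (0, 0, 2, 1)), (-1, (0, 1, 1, 0))],
    [(1, (1, 1, 0, 1)), (-1, (0, 0, 2, 0)), (1, (0, 0, 2, 1))],
    [(1, (1, 1, 1, 0)), (1, (0, 0, 2, 1)), (1, (0, 0, 3, 0)), (-1, (0, 1, 1, 0)), (-1, (0, 1, 1, 1))],
    [(1, (2, 0, 1, 0)), (1, (0, 0, 2, 0))],
    [(1, (2, 1, 0, 0)), (1, (0, 1, 1, 0))]]"

definition G5 :: "(int \<times> expt) list list" where
  "G5 = [
    [(1, (0, 0, 1, 2)), (1, (1, 0, 1, 0))],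
    [(1, (0, 0, 2, 1)), (1, (0, 0, 3, 0)), (-1, (0, 1, 1, 0)), (-1, (0, 1, 1, 1)), (1, (1, 1, 1, 0))],
    [(2, (0, 0, 6, 0)), (2, (0, 0, 5, 0)), (1, (0, 1, 3, 0)), (-3, (0, 1, 4, 0)), (4, (0, 1, 5, 0)),
      (-2, (0, 2, 2, 0)), (-10, (0, 2, 3, 0)), (-1, (0, 3, 1, 0)), (12, (0, 3, 2, 0)),
      (-1, (1, 3, 0, 0)), (8, (1, 4, 0, 0))],
    [(2, (0, 2, 1, 1)), (-1, (0, 0, 3, 0)), (-3, (0, 0, 4, 0)), (-2, (0, 0, 5, 0)), (2, (0, 1, 2, 0)),
      (6, (0, 1, 3, 0)), (1, (0, 2, 1, 0)), (-6, (0, 2, 2, 0)), (1, (1, 2, 0, 0)), (-4, (1, 3, 0, 0))],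
    [(1, (1, 0, 0, 2)), (-1, (0, 0, 1, 0))],
    [(1, (1, 0, 1, 1)), (-1, (0, 0, 2, 0)), (-1, (1, 1, 0, 0))],
    [(1, (1, 0, 2, 0)), (-1, (0, 0, 3, 0)), (1, (0, 1, 1, 1)), (-1, (1, 1, 1, 0))],
    [(1, (1, 1, 0, 1)), (-1, (0, 0, 2, 0)), (-1, (0, 0, 3, 0)), (1, (0, 1, 1, 0)), (1, (0, 1, 1, 1)),
      (-1, (1, 1, 1, 0))],
    [(1, (1, 2, 1, 0)), (-1, (0, 0, 4, 0)), (-1, (0, 0, 5, 0)), (4, (0, 1, 3, 0)), (-3, (0, 2, 2, 0)),
      (-2, (1, 3, 0, 0))],
    [(1, (2, 0, 1, 0)), (1, (0, 0, 2, 0))],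
    [(1, (2, 1, 0, 0)), (1, (0, 1, 1, 0))]]"

definition G6 :: "(int \<times> expt) list list" where
  "G6 = [
    [(1, (0, 0, 1, 4)), (1, (0, 0, 2, 0))],
    [(1, (0, 0, 2, 2)), (-1, (0, 0, 2, 1)), (1, (0, 1, 1, 0))],
    [(1, (0, 0, 4, 0)), (1, (0, 0, 3, 1)), (-1, (0, 1, 2, 0)), (-2, (0, 1, 2, 1)), (1, (0, 2, 1, 0))],
    [(1, (0, 1, 1, 2)), (-1, (0, 0, 2, 1)), (-1, (0, 0, 3, 0)), (1, (0, 1, 1, 0)), (1, (0, 1, 1, 1))],
    [(1, (1, 0, 0, 2)), (-1, (0, 0, 1, 0))],
    [(1, (1, 0, 1, 0)), (1, (0, 0, 1, 2))],
    [(1, (1, 1, 0, 0)), (1, (0, 0, 1, 3)), (1, (0, 0, 2, 0))]]"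

definition G7 :: "(int \<times> expt) list list" where
  "G7 = [
    [(1, (0, 0, 1, 3)), (1, (0, 0, 2, 0)), (1, (1, 1, 0, 0))],
    [(1, (0, 0, 2, 2)), (-1, (0, 0, 2, 1)), (1, (0, 1, 1, 0))],
    [(1, (0, 0, 3, 1)), (1, (0, 0, 4, 0)), (-1, (0, 1, 2, 0)), (-2, (0, 1, 2, 1)), (1, (0, 2, 1, 0))],
    [(1, (0, 0, 5, 0)), (1, (0, 0, 4, 0)), (1, (0, 1, 2, 1)), (-1, (0, 1, 3, 0)), (2, (0, 1, 4, 0)),
      (-1, (0, 2, 1, 0)), (-1, (0, 2, 1, 1)), (-1, (0, 2, 2, 0)), (-4, (0, 2, 2, 1)),
      (2, (0, 3, 1, 0))],
    [(1, (0, 1, 1, 2)), (-1, (0, 0, 2, 1)), (-1, (0, 0, 3, 0)), (1, (0, 1, 1, 0)), (1, (0, 1, 1, 1))],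
    [(1, (1, 0, 0, 2)), (-1, (0, 0, 1, 0))],
    [(1, (1, 0, 1, 0)), (1, (0, 0, 1, 2))],
    [(1, (1, 1, 0, 1)), (-1, (0, 0, 2, 0)), (1, (0, 0, 2, 1))],
    [(1, (1, 2, 0, 0)), (-1, (0, 0, 3, 0)), (-1, (0, 0, 4, 0)), (2, (0, 1, 2, 0)), (2, (0, 1, 2, 1)),
      (-1, (0, 2, 1, 0))],
    [(1, (2, 1, 0, 0)), (1, (0, 1, 1, 0))]]"

definition G8 :: "(int \<times> expt) list list" where
  "G8 = [
    [(1, (0, 0, 1, 2)), (1, (1, 0, 1, 0))],
    [(1, (0, 0, 3, 1)), (1, (0, 0, 4, 0)), (-1, (0, 1, 2, 0)), (-2, (0, 1, 2, 1)), (1, (0, 2, 1, 0))],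
    [(4, (0, 0, 6, 0)), (-1, (0, 0, 4, 0)), (3, (0, 0, 5, 0)), (-1, (0, 1, 2, 1)), (1, (0, 1, 3, 0)),
      (-18, (0, 1, 4, 0)), (1, (0, 2, 1, 0)), (1, (0, 2, 1, 1)), (1, (0, 2, 2, 0)), (4, (0, 2, 3, 0)),
      (2, (0, 3, 1, 0)), (8, (0, 3, 1, 1))],
    [(4, (0, 2, 2, 1)), (-1, (0, 0, 4, 0)), (-1, (0, 0, 5, 0)), (-1, (0, 1, 2, 1)), (1, (0, 1, 3, 0)),
      (-2, (0, 1, 4, 0)), (1, (0, 2, 1, 0)), (1, (0, 2, 1, 1)), (1, (0, 2, 2, 0)), (-2, (0, 3, 1, 0))],
    [(1, (1, 0, 0, 2)), (-1, (0, 0, 1, 0))],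
    [(1, (1, 0, 1, 1)), (-1, (0, 0, 2, 0)), (-1, (1, 1, 0, 0))],
    [(1, (1, 0, 2, 0)), (1, (0, 0, 2, 1)), (-1, (0, 1, 1, 0))],
    [(1, (1, 1, 0, 1)), (-1, (0, 0, 2, 0)), (1, (0, 0, 2, 1))],
    [(1, (1, 1, 1, 0)), (1, (0, 0, 2, 1)), (1, (0, 0, 3, 0)), (-1, (0, 1, 1, 0)), (-1, (0, 1, 1, 1))],
    [(1, (1, 2, 0, 0)), (-1, (0, 0, 3, 0)), (-1, (0, 0, 4, 0)), (2, (0, 1, 2, 0)), (2, (0, 1, 2, 1)),
      (-1, (0, 2, 1, 0))],
    [(1, (2, 0, 1, 0)), (1, (0, 0, 2, 0))],
    [(1, (2, 1, 0, 0)), (1, (0, 1, 1, 0))]]"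

definition G9 :: "(int \<times> expt) list list" where
  "G9 = [
    [(1, (0, 0, 1, 2)), (1, (1, 0, 1, 0))],
    [(1, (0, 0, 3, 1)), (-1, (0, 0, 3, 0)), (1, (0, 1, 2, 0)), (1, (1, 2, 0, 0))],
    [(8, (0, 0, 6, 0)), (-1, (0, 0, 3, 0)), (-3, (0, 0, 4, 0)), (6, (0, 0, 5, 0)), (2, (0, 1, 2, 0)),
      (2, (0, 1, 3, 0)), (-36, (0, 1, 4, 0)), (1, (0, 2, 1, 0)), (2, (0, 2, 1, 1)), (2, (0, 2, 2, 0)),
      (8, (0, 2, 3, 0)), (4, (0, 3, 1, 0)), (16, (0, 3, 1, 1)), (1, (1, 2, 0, 0))],
    [(2, (0, 1, 2, 1)), (-1, (0, 0, 3, 0)), (-1, (0, 0, 4, 0)), (2, (0, 1, 2, 0)), (-1, (0, 2, 1, 0)),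
      (1, (1, 2, 0, 0))],
    [(1, (1, 0, 0, 2)), (-1, (0, 0, 1, 0))],
    [(1, (1, 0, 1, 1)), (-1, (0, 0, 2, 0)), (-1, (1, 1, 0, 0))],
    [(1, (1, 0, 2, 0)), (1, (0, 0, 2, 1)), (-1, (0, 1, 1, 0))],
    [(1, (1, 1, 0, 1)), (-1, (0, 0, 2, 0)), (1, (0, 0, 2, 1))],
    [(1, (1, 1, 1, 0)), (1, (0, 0, 2, 1)), (1, (0, 0, 3, 0)), (-1, (0, 1, 1, 0)), (-1, (0, 1, 1, 1))],
    [(4, (1, 3, 0, 0)), (1, (0, 0, 3, 0)), (3, (0, 0, 4, 0)), (2, (0, 0, 5, 0)), (-2, (0, 1, 2, 0)),
      (-6, (0, 1, 3, 0)), (-1, (0, 2, 1, 0)), (-2, (0, 2, 1, 1)), (6, (0, 2, 2, 0)),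
      (-1, (1, 2, 0, 0))],
    [(1, (2, 0, 1, 0)), (1, (0, 0, 2, 0))],
    [(1, (2, 1, 0, 0)), (1, (0, 1, 1, 0))]]"

definition G10 :: "(int \<times> expt) list list" where
  "G10 = [
    [(1, (0, 0, 1, 2)), (1, (1, 0, 1, 0))],
    [(2, (0, 0, 4, 1)), (-1, (0, 0, 3, 1)), (-3, (0, 0, 4, 0)), (1, (0, 1, 2, 0)), (1, (0, 2, 1, 0)),
      (2, (0, 2, 1, 1))],
    [(8, (0, 0, 6, 0)), (-1, (0, 0, 3, 1)), (-3, (0, 0, 4, 0)), (6, (0, 0, 5, 0)), (1, (0, 1, 2, 0)),
      (2, (0, 1, 3, 0)), (-36, (0, 1, 4, 0)), (1, (0, 2, 1, 0)), (2, (0, 2, 1, 1)), (2, (0, 2, 2, 0)),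
      (8, (0, 2, 3, 0)), (4, (0, 3, 1, 0)), (16, (0, 3, 1, 1))],
    [(2, (0, 1, 2, 1)), (-1, (0, 0, 3, 1)), (-1, (0, 0, 4, 0)), (1, (0, 1, 2, 0)), (-1, (0, 2, 1, 0))],
    [(1, (1, 0, 0, 2)), (-1, (0, 0, 1, 0))],
    [(1, (1, 0, 1, 1)), (-1, (0, 0, 2, 0)), (-1, (1, 1, 0, 0))],
    [(1, (1, 0, 2, 0)), (1, (0, 0, 2, 1)), (-1, (0, 1, 1, 0))],
    [(1, (1, 1, 0, 1)), (-1, (0, 0, 2, 0)), (1, (0, 0, 2, 1))],
    [(1, (1, 1, 1, 0)), (1, (0, 0, 2, 1)), (1, (0, 0, 3, 0)), (-1, (0, 1, 1, 0)), (-1, (0, 1, 1, 1))],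
    [(1, (1, 2, 0, 0)), (-1, (0, 0, 3, 0)), (1, (0, 0, 3, 1)), (1, (0, 1, 2, 0))],
    [(1, (2, 0, 1, 0)), (1, (0, 0, 2, 0))],
    [(1, (2, 1, 0, 0)), (1, (0, 1, 1, 0))]]"

definition T0 :: "(expt \<times> bool) list" where
  "T0 = [((0, 0, 1, 0), True), ((0, 0, 1, 1), True), ((0, 0, 1, 2), True), ((0, 0, 1, 3), True),
    ((0, 0, 1, 4), True), ((0, 0, 1, 5), True)]"

definition T1 :: "(expt \<times> bool) list" where
  "T1 = [((0, 0, 1, 0), True), ((0, 0, 1, 1), True), ((0, 0, 2, 0), True), ((1, 0, 1, 0), True),
    ((1, 1, 0, 0), True), ((1, 1, 0, 1), True)]"

definition T2 :: "(expt \<times> bool) list" where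
  "T2 = [((0, 0, 1, 0), True), ((0, 0, 1, 1), True), ((0, 0, 2, 0), True), ((0, 0, 3, 0), True),
    ((1, 0, 1, 0), True), ((1, 1, 0, 0), True)]"

definition T3 :: "(expt \<times> bool) list" where
  "T3 = [((0, 0, 1, 0), True), ((0, 0, 1, 1), False), ((0, 0, 2, 0), True), ((0, 0, 3, 0), True),
    ((0, 0, 4, 0), True), ((0, 1, 1, 1), False), ((1, 0, 1, 0), True), ((1, 1, 0, 0), True)]"

definition T4 :: "(expt \<times> bool) list" where
  "T4 = [((0, 0, 1, 0), True), ((0, 0, 1, 1), True), ((0, 0, 2, 0), True), ((0, 0, 2, 1), False),
    ((0, 0, 3, 0), True), ((0, 0, 4, 0), True), ((1, 0, 1, 0), False), ((1, 1, 0, 0), True)]"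

definition T5 :: "(expt \<times> bool) list" where
  "T5 = [((0, 0, 1, 0), True), ((0, 0, 1, 1), False), ((0, 0, 2, 0), True), ((0, 0, 3, 0), True),
    ((0, 0, 4, 0), True), ((0, 0, 5, 0), True), ((0, 1, 1, 1), False), ((1, 0, 1, 0), False),
    ((1, 1, 0, 0), True), ((1, 1, 1, 0), False)]"

definition T6 :: "(expt \<times> bool) list" where
  "T6 = [((0, 0, 1, 0), True), ((0, 0, 1, 1), True), ((0, 0, 1, 2), False), ((0, 0, 1, 3), False),
    ((0, 0, 2, 0), True), ((0, 0, 2, 1), True), ((0, 0, 3, 0), True), ((0, 0, 3, 1), True)]"

definition T7 :: "(expt \<times> bool) list" where
  "T7 = [((0, 0, 1, 0), True), ((0, 0, 1, 1), True), ((0, 0, 1, 2), False), ((0, 0, 2, 0), True),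
    ((0, 0, 2, 1), True), ((0, 0, 3, 0), True), ((0, 0, 4, 0), True), ((1, 1, 0, 0), False)]"

definition T8 :: "(expt \<times> bool) list" where
  "T8 = [((0, 0, 1, 0), True), ((0, 0, 1, 1), True), ((0, 0, 2, 0), True), ((0, 0, 2, 1), False),
    ((0, 0, 3, 0), True), ((0, 0, 4, 0), True), ((0, 0, 5, 0), True), ((0, 1, 2, 1), False),
    ((1, 0, 1, 0), False), ((1, 1, 0, 0), False)]"

definition T9 :: "(expt \<times> bool) list" where
  "T9 = [((0, 0, 1, 0), True), ((0, 0, 1, 1), True), ((0, 0, 2, 0), True), ((0, 0, 2, 1), False),
    ((0, 0, 3, 0), True), ((0, 0, 4, 0), True), ((0, 0, 5, 0), True), ((1, 0, 1, 0), False),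
    ((1, 1, 0, 0), False), ((1, 2, 0, 0), False)]"

definition T10 :: "(expt \<times> bool) list" where
  "T10 = [((0, 0, 1, 0), True), ((0, 0, 1, 1), True), ((0, 0, 2, 0), True), ((0, 0, 2, 1), False),
    ((0, 0, 3, 0), True), ((0, 0, 3, 1), False), ((0, 0, 4, 0), True), ((0, 0, 5, 0), True),
    ((1, 0, 1, 0), False), ((1, 1, 0, 0), False)]"


section \<open>Independence of the standard monomials\<close>

lemma indep_T0: "indep (cells T0)"
proof (rule indep_wdeg)
  \<comment> \<open>The weighted degree of b^n c d^l is 6 n + 4 + l with l < 6, so division with
    remainder recovers n and l.\<close>
  show "inj_on wdeg (cells T0)"
    unfolding T0_def cells_def inj_on_def by (auto simp: wdeg.simps) presburger+
qed

text \<open>In each relation the first monomial leaves and the second enters. The strings of cd^4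
  and cd^5 become those of c^2 and c^2 d; then the strings from bcd^2 and bcd^3 become those of c^3
  and c^3 d, leaving cd^2 and cd^3 as single monomials.\<close>

lemma indep_T6: "indep (cells T6)"
proof -
  have step0: "indep (cells [((0, 0, 1, 0), True), ((0, 0, 1, 1), True), ((0, 0, 1, 2), True),
    ((0, 0, 1, 3), True), ((0, 0, 1, 5), True), ((0, 0, 2, 0), True)])"
  proof (rule indep_step [OF indep_T0])
    show "phi (poly_of [(1, (0, 0, 1, 4)), (1, (0, 0, 2, 0))]) = 0"
      by (rule phi_poly_of_0; simp; algebra)
    show "list_all (covers T0) (((0, 0, 1, 4), True) # [((0, 0, 1, 0), True), ((0, 0, 1, 1), True),
      ((0, 0, 1, 2), True), ((0, 0, 1, 3), True), ((0, 0, 1, 5), True)])"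
      by (simp add: T0_def)
  qed simp_all
  have step1: "indep (cells [((0, 0, 1, 0), True), ((0, 0, 1, 1), True), ((0, 0, 1, 2), True),
    ((0, 0, 1, 3), True), ((0, 0, 2, 0), True), ((0, 0, 2, 1), True)])"
  proof (rule indep_step [OF step0])
    show "phi (poly_of [(1, (0, 0, 1, 5)), (1, (0, 0, 2, 1))]) = 0"
      by (rule phi_poly_of_0; simp; algebra)
    show "list_all (covers [((0, 0, 1, 0), True), ((0, 0, 1, 1), True), ((0, 0, 1, 2), True),
      ((0, 0, 1, 3), True), ((0, 0, 1, 5), True),
      ((0, 0, 2, 0), True)]) (((0, 0, 1, 5), True) # [((0, 0, 1, 0), True), ((0, 0, 1, 1), True),
      ((0, 0, 1, 2), True), ((0, 0, 1, 3), True), ((0, 0, 2, 0), True)])"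
      by simp
  qed simp_all
  have step2: "indep (cells [((0, 0, 1, 0), True), ((0, 0, 1, 1), True), ((0, 0, 1, 2), False),
    ((0, 0, 1, 3), True), ((0, 0, 2, 0), True), ((0, 0, 2, 1), True), ((0, 0, 3, 0), True)])"
  proof (rule indep_step [OF step1])
    show "phi (poly_of [(-1, (0, 1, 1, 2)), (1, (0, 0, 3, 0)), (1, (0, 0, 2, 1)), (-1, (0, 1, 1, 0)),
      (-1, (0, 1, 1, 1))]) = 0"
      by (rule phi_poly_of_0; simp; algebra)
    show "list_all (covers [((0, 0, 1, 0), True), ((0, 0, 1, 1), True), ((0, 0, 1, 2), True),
      ((0, 0, 1, 3), True), ((0, 0, 2, 0), True),
      ((0, 0, 2, 1), True)]) (((0, 1, 1, 2), True) # [((0, 0, 1, 0), True), ((0, 0, 1, 1), True),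
      ((0, 0, 1, 2), False), ((0, 0, 1, 3), True), ((0, 0, 2, 0), True), ((0, 0, 2, 1), True)])"
      by simp
  qed simp_all
  show ?thesis
  proof (rule indep_step [OF step2])
    show "phi (poly_of [(-1, (0, 1, 1, 3)), (1, (0, 0, 3, 1)), (-1, (0, 0, 3, 0))]) = 0"
      by (rule phi_poly_of_0; simp; algebra)
    show "list_all (covers [((0, 0, 1, 0), True), ((0, 0, 1, 1), True), ((0, 0, 1, 2), False),
      ((0, 0, 1, 3), True), ((0, 0, 2, 0), True), ((0, 0, 2, 1), True),
      ((0, 0, 3, 0), True)]) (((0, 1, 1, 3), True) # [((0, 0, 1, 0), True), ((0, 0, 1, 1), True),
      ((0, 0, 1, 2), False), ((0, 0, 1, 3), False), ((0, 0, 2, 0), True), ((0, 0, 2, 1), True),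
      ((0, 0, 3, 0), True)])"
      by simp
  qed (simp_all add: T6_def)
qed

lemma indep_T1: "indep (cells T1)"
proof -
  have step0: "indep (cells [((0, 0, 1, 0), True), ((0, 0, 1, 1), True), ((0, 0, 1, 2), True),
    ((0, 0, 1, 3), True), ((0, 0, 1, 4), True), ((1, 1, 0, 1), True)])"
  proof (rule indep_step [OF indep_T0])
    show "phi (poly_of [(-1, (0, 0, 1, 5)), (1, (1, 1, 0, 1)), (1, (0, 0, 1, 4))]) = 0"
      by (rule phi_poly_of_0; simp; algebra)
    show "list_all (covers T0) (((0, 0, 1, 5), True) # [((0, 0, 1, 0), True), ((0, 0, 1, 1), True),
      ((0, 0, 1, 2), True), ((0, 0, 1, 3), True), ((0, 0, 1, 4), True)])"
      by (simp add: T0_def)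
  qed simp_all
  have step1: "indep (cells [((0, 0, 1, 0), True), ((0, 0, 1, 1), True), ((0, 0, 1, 2), True),
    ((0, 0, 1, 3), True), ((1, 1, 0, 0), True), ((1, 1, 0, 1), True)])"
  proof (rule indep_step [OF step0])
    show "phi (poly_of [(-1, (0, 0, 1, 4)), (1, (1, 1, 0, 0)), (1, (0, 0, 1, 3))]) = 0"
      by (rule phi_poly_of_0; simp; algebra)
    show "list_all (covers [((0, 0, 1, 0), True), ((0, 0, 1, 1), True), ((0, 0, 1, 2), True),
      ((0, 0, 1, 3), True), ((0, 0, 1, 4), True),
      ((1, 1, 0, 1), True)]) (((0, 0, 1, 4), True) # [((0, 0, 1, 0), True), ((0, 0, 1, 1), True),
      ((0, 0, 1, 2), True), ((0, 0, 1, 3), True), ((1, 1, 0, 1), True)])"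
      by simp
  qed simp_all
  have step2: "indep (cells [((0, 0, 1, 0), True), ((0, 0, 1, 1), True), ((0, 0, 1, 2), True),
    ((0, 0, 2, 0), True), ((1, 1, 0, 0), True), ((1, 1, 0, 1), True)])"
  proof (rule indep_step [OF step1])
    show "phi (poly_of [(1, (0, 0, 1, 3)), (1, (0, 0, 2, 0)), (1, (1, 1, 0, 0))]) = 0"
      by (rule phi_poly_of_0; simp; algebra)
    show "list_all (covers [((0, 0, 1, 0), True), ((0, 0, 1, 1), True), ((0, 0, 1, 2), True),
      ((0, 0, 1, 3), True), ((1, 1, 0, 0), True),
      ((1, 1, 0, 1), True)]) (((0, 0, 1, 3), True) # [((0, 0, 1, 0), True), ((0, 0, 1, 1), True),
      ((0, 0, 1, 2), True), ((1, 1, 0, 0), True), ((1, 1, 0, 1), True)])"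
      by simp
  qed simp_all
  show ?thesis
  proof (rule indep_step [OF step2])
    show "phi (poly_of [(1, (0, 0, 1, 2)), (1, (1, 0, 1, 0))]) = 0"
      by (rule phi_poly_of_0; simp; algebra)
    show "list_all (covers [((0, 0, 1, 0), True), ((0, 0, 1, 1), True), ((0, 0, 1, 2), True),
      ((0, 0, 2, 0), True), ((1, 1, 0, 0), True),
      ((1, 1, 0, 1), True)]) (((0, 0, 1, 2), True) # [((0, 0, 1, 0), True), ((0, 0, 1, 1), True),
      ((0, 0, 2, 0), True), ((1, 1, 0, 0), True), ((1, 1, 0, 1), True)])"
      by simp
  qed (simp_all add: T1_def)
qed

lemma indep_T2: "indep (cells T2)"
  proof (rule indep_step [OF indep_T1])
    show "phi (poly_of [(-1, (1, 1, 0, 1)), (1, (0, 0, 3, 0)), (1, (0, 0, 2, 0)), (-1, (0, 1, 1, 0)),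
      (-1, (0, 1, 1, 1)), (1, (1, 1, 1, 0))]) = 0"
      by (rule phi_poly_of_0; simp; algebra)
    show "list_all (covers T1) (((1, 1, 0, 1), True) # [((0, 0, 1, 0), True), ((0, 0, 1, 1), True),
      ((0, 0, 2, 0), True), ((1, 0, 1, 0), True), ((1, 1, 0, 0), True)])"
      by (simp add: T1_def)
  qed (simp_all add: T2_def)

lemma indep_T3: "indep (cells T3)"
  proof (rule indep_step [OF indep_T2])
    show "phi (poly_of [(-2, (0, 2, 1, 1)), (1, (0, 0, 4, 0)), (1, (0, 0, 3, 0)), (-2, (0, 1, 2, 0)),
      (2, (0, 1, 3, 0)), (-1, (0, 2, 1, 0)), (-1, (1, 2, 0, 0)), (2, (1, 2, 1, 0))]) = 0"
      by (rule phi_poly_of_0; simp; algebra)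
    show "list_all (covers T2) (((0, 2, 1, 1), True) # [((0, 0, 1, 0), True), ((0, 0, 1, 1), False),
      ((0, 0, 2, 0), True), ((0, 0, 3, 0), True), ((0, 1, 1, 1), False), ((1, 0, 1, 0), True),
      ((1, 1, 0, 0), True)])"
      by (simp add: T2_def)
  qed (simp_all add: T3_def)

lemma indep_T5: "indep (cells T5)"
  proof (rule indep_step [OF indep_T3])
    show "phi (poly_of [(-1, (1, 2, 1, 0)), (1, (0, 0, 5, 0)), (1, (0, 0, 4, 0)), (-4, (0, 1, 3, 0)),
      (3, (0, 2, 2, 0)), (2, (1, 3, 0, 0))]) = 0"
      by (rule phi_poly_of_0; simp; algebra)
    show "list_all (covers T3) (((1, 2, 1, 0), True) # [((0, 0, 1, 0), True), ((0, 0, 1, 1), False),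
      ((0, 0, 2, 0), True), ((0, 0, 3, 0), True), ((0, 0, 4, 0), True), ((0, 1, 1, 1), False),
      ((1, 0, 1, 0), False), ((1, 1, 0, 0), True), ((1, 1, 1, 0), False)])"
      by (simp add: T3_def)
  qed (simp_all add: T5_def)

text \<open>The relation that leads from \<open>T2\<close> to \<open>T3\<close> is used again, now
  giving up the string of ab^2c instead of that of b^2cd. Afterwards the single monomial abc is
  traded for c^2 d.\<close>

lemma indep_T4: "indep (cells T4)"
proof -
  have step0: "indep (cells [((0, 0, 1, 0), True), ((0, 0, 1, 1), True), ((0, 0, 2, 0), True),
    ((0, 0, 3, 0), True), ((0, 0, 4, 0), True), ((1, 0, 1, 0), False), ((1, 1, 0, 0), True),
    ((1, 1, 1, 0), False)])"
  proof (rule indep_step [OF indep_T2])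
    show "phi (poly_of [(2, (1, 2, 1, 0)), (1, (0, 0, 4, 0)), (1, (0, 0, 3, 0)), (-2, (0, 1, 2, 0)),
      (2, (0, 1, 3, 0)), (-1, (0, 2, 1, 0)), (-2, (0, 2, 1, 1)), (-1, (1, 2, 0, 0))]) = 0"
      by (rule phi_poly_of_0; simp; algebra)
    show "list_all (covers T2) (((1, 2, 1, 0), True) # [((0, 0, 1, 0), True), ((0, 0, 1, 1), True),
      ((0, 0, 2, 0), True), ((0, 0, 3, 0), True), ((1, 0, 1, 0), False), ((1, 1, 0, 0), True),
      ((1, 1, 1, 0), False)])"
      by (simp add: T2_def)
  qed simp_all
  show ?thesis
  proof (rule indep_step [OF step0])
    show "phi (poly_of [(1, (1, 1, 1, 0)), (1, (0, 0, 2, 1)), (1, (0, 0, 3, 0)), (-1, (0, 1, 1, 0)),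
      (-1, (0, 1, 1, 1))]) = 0"
      by (rule phi_poly_of_0; simp; algebra)
    show "list_all (covers [((0, 0, 1, 0), True), ((0, 0, 1, 1), True), ((0, 0, 2, 0), True),
      ((0, 0, 3, 0), True), ((0, 0, 4, 0), True), ((1, 0, 1, 0), False), ((1, 1, 0, 0), True),
      ((1, 1, 1, 0), False)]) (((1, 1, 1, 0), False) # [((0, 0, 1, 0), True), ((0, 0, 1, 1), True),
      ((0, 0, 2, 0), True), ((0, 0, 3, 0), True), ((0, 0, 4, 0), True), ((1, 0, 1, 0), False),
      ((1, 1, 0, 0), True)])"
      by simp
  qed (simp_all add: T4_def)
qed

lemma indep_T7: "indep (cells T7)"
proof -
  have step0: "indep (cells [((0, 0, 1, 0), True), ((0, 0, 1, 1), True), ((0, 0, 2, 0), True),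
    ((0, 0, 2, 1), True), ((0, 0, 3, 0), True), ((0, 0, 4, 0), True), ((1, 0, 1, 0), False),
    ((1, 1, 0, 0), False)])"
  \<comment> \<open>The string entering at bc^2d merges with the single monomial c^2 d into one
    string.\<close>
  proof (rule indep_step [OF indep_T4])
    show "phi (poly_of [(1, (1, 2, 0, 0)), (2, (0, 1, 2, 1)), (-1, (0, 0, 3, 0)), (-1, (0, 0, 4, 0)),
      (2, (0, 1, 2, 0)), (-1, (0, 2, 1, 0))]) = 0"
      by (rule phi_poly_of_0; simp; algebra)
    show "list_all (covers T4) (((1, 2, 0, 0), True) # [((0, 0, 1, 0), True), ((0, 0, 1, 1), True),
      ((0, 0, 2, 0), True), ((0, 0, 2, 1), False), ((0, 0, 3, 0), True), ((0, 0, 4, 0), True),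
      ((1, 0, 1, 0), False), ((1, 1, 0, 0), False)])"
      by (simp add: T4_def)
  qed simp_all
  show ?thesis
  proof (rule indep_step [OF step0])
    show "phi (poly_of [(1, (1, 0, 1, 0)), (1, (0, 0, 1, 2))]) = 0"
      by (rule phi_poly_of_0; simp; algebra)
    show "list_all (covers [((0, 0, 1, 0), True), ((0, 0, 1, 1), True), ((0, 0, 2, 0), True),
      ((0, 0, 2, 1), True), ((0, 0, 3, 0), True), ((0, 0, 4, 0), True), ((1, 0, 1, 0), False),
      ((1, 1, 0, 0), False)]) (((1, 0, 1, 0), False) # [((0, 0, 1, 0), True), ((0, 0, 1, 1), True),
      ((0, 0, 2, 0), True), ((0, 0, 2, 1), True), ((0, 0, 3, 0), True), ((0, 0, 4, 0), True),
      ((1, 1, 0, 0), False)])"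
      by simp
  qed (simp_all add: T7_def)
qed

text \<open>The tail of the first relation contains ab^2, and b^n ab^2 = b^(n - 1) ab^3 for n > 0
  falls into the departing string: here the triangular form of the exchange matters. The same step
  gives \<open>T9\<close> and opens the way to \<open>T10\<close>.\<close>

lemma indep_T8: "indep (cells T8)"
proof -
  have step0: "indep (cells [((0, 0, 1, 0), True), ((0, 0, 1, 1), True), ((0, 0, 2, 0), True),
    ((0, 0, 2, 1), False), ((0, 0, 3, 0), True), ((0, 0, 4, 0), True), ((0, 0, 5, 0), True),
    ((1, 0, 1, 0), False), ((1, 1, 0, 0), False), ((1, 2, 0, 0), False)])"
  proof (rule indep_step [OF indep_T4])
    show "phi (poly_of [(4, (1, 3, 0, 0)), (2, (0, 0, 5, 0)), (1, (0, 0, 3, 0)), (3, (0, 0, 4, 0)),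
      (-2, (0, 1, 2, 0)), (-6, (0, 1, 3, 0)), (-1, (0, 2, 1, 0)), (-2, (0, 2, 1, 1)),
      (6, (0, 2, 2, 0)), (-1, (1, 2, 0, 0))]) = 0"
      by (rule phi_poly_of_0; simp; algebra)
    show "list_all (covers T4) (((1, 3, 0, 0), True) # [((0, 0, 1, 0), True), ((0, 0, 1, 1), True),
      ((0, 0, 2, 0), True), ((0, 0, 2, 1), False), ((0, 0, 3, 0), True), ((0, 0, 4, 0), True),
      ((1, 0, 1, 0), False), ((1, 1, 0, 0), False), ((1, 2, 0, 0), False)])"
      by (simp add: T4_def)
  qed simp_all
  show ?thesis
  proof (rule indep_step [OF step0])
    show "phi (poly_of [(1, (1, 2, 0, 0)), (2, (0, 1, 2, 1)), (-1, (0, 0, 3, 0)), (-1, (0, 0, 4, 0)),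
      (2, (0, 1, 2, 0)), (-1, (0, 2, 1, 0))]) = 0"
      by (rule phi_poly_of_0; simp; algebra)
    show "list_all (covers [((0, 0, 1, 0), True), ((0, 0, 1, 1), True), ((0, 0, 2, 0), True),
      ((0, 0, 2, 1), False), ((0, 0, 3, 0), True), ((0, 0, 4, 0), True), ((0, 0, 5, 0), True),
      ((1, 0, 1, 0), False), ((1, 1, 0, 0), False),
      ((1, 2, 0, 0), False)]) (((1, 2, 0, 0), False) # [((0, 0, 1, 0), True), ((0, 0, 1, 1), True),
      ((0, 0, 2, 0), True), ((0, 0, 2, 1), False), ((0, 0, 3, 0), True), ((0, 0, 4, 0), True),
      ((0, 0, 5, 0), True), ((1, 0, 1, 0), False), ((1, 1, 0, 0), False)])"
      by simp
  qed (simp_all add: T8_def)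
qed

lemma indep_T9: "indep (cells T9)"
  proof (rule indep_step [OF indep_T4])
    show "phi (poly_of [(4, (1, 3, 0, 0)), (2, (0, 0, 5, 0)), (1, (0, 0, 3, 0)), (3, (0, 0, 4, 0)),
      (-2, (0, 1, 2, 0)), (-6, (0, 1, 3, 0)), (-1, (0, 2, 1, 0)), (-2, (0, 2, 1, 1)),
      (6, (0, 2, 2, 0)), (-1, (1, 2, 0, 0))]) = 0"
      by (rule phi_poly_of_0; simp; algebra)
    show "list_all (covers T4) (((1, 3, 0, 0), True) # [((0, 0, 1, 0), True), ((0, 0, 1, 1), True),
      ((0, 0, 2, 0), True), ((0, 0, 2, 1), False), ((0, 0, 3, 0), True), ((0, 0, 4, 0), True),
      ((1, 0, 1, 0), False), ((1, 1, 0, 0), False), ((1, 2, 0, 0), False)])"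
      by (simp add: T4_def)
  qed (simp_all add: T9_def)

lemma indep_T10: "indep (cells T10)"
proof -
  have step0: "indep (cells [((0, 0, 1, 0), True), ((0, 0, 1, 1), True), ((0, 0, 2, 0), True),
    ((0, 0, 2, 1), False), ((0, 0, 3, 0), True), ((0, 0, 4, 0), True), ((0, 0, 5, 0), True),
    ((1, 0, 1, 0), False), ((1, 1, 0, 0), False), ((1, 2, 0, 0), False)])"
  proof (rule indep_step [OF indep_T4])
    show "phi (poly_of [(4, (1, 3, 0, 0)), (2, (0, 0, 5, 0)), (1, (0, 0, 3, 0)), (3, (0, 0, 4, 0)),
      (-2, (0, 1, 2, 0)), (-6, (0, 1, 3, 0)), (-1, (0, 2, 1, 0)), (-2, (0, 2, 1, 1)),
      (6, (0, 2, 2, 0)), (-1, (1, 2, 0, 0))]) = 0"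
      by (rule phi_poly_of_0; simp; algebra)
    show "list_all (covers T4) (((1, 3, 0, 0), True) # [((0, 0, 1, 0), True), ((0, 0, 1, 1), True),
      ((0, 0, 2, 0), True), ((0, 0, 2, 1), False), ((0, 0, 3, 0), True), ((0, 0, 4, 0), True),
      ((1, 0, 1, 0), False), ((1, 1, 0, 0), False), ((1, 2, 0, 0), False)])"
      by (simp add: T4_def)
  qed simp_all
  show ?thesis
  proof (rule indep_step [OF step0])
    show "phi (poly_of [(1, (1, 2, 0, 0)), (1, (0, 0, 3, 1)), (-1, (0, 0, 3, 0)),
      (1, (0, 1, 2, 0))]) = 0"
      by (rule phi_poly_of_0; simp; algebra)
    show "list_all (covers [((0, 0, 1, 0), True), ((0, 0, 1, 1), True), ((0, 0, 2, 0), True),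
      ((0, 0, 2, 1), False), ((0, 0, 3, 0), True), ((0, 0, 4, 0), True), ((0, 0, 5, 0), True),
      ((1, 0, 1, 0), False), ((1, 1, 0, 0), False),
      ((1, 2, 0, 0), False)]) (((1, 2, 0, 0), False) # [((0, 0, 1, 0), True), ((0, 0, 1, 1), True),
      ((0, 0, 2, 0), True), ((0, 0, 2, 1), False), ((0, 0, 3, 0), True), ((0, 0, 4, 0), True),
      ((0, 0, 5, 0), True), ((1, 0, 1, 0), False), ((1, 1, 0, 0), False)])"
      by simp
  qed (simp_all add: T10_def)
qed

section \<open>Verification of the bases\<close>

lemma jensen_ideal_diff: "f \<in> jensen_ideal \<Longrightarrow> g \<in> jensen_ideal \<Longrightarrow> f - g \<in> jensen_ideal"
  unfolding jensen_ideal_def by (rule ideal_of_diff)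

lemma jensen_ideal_mult: "f \<in> jensen_ideal \<Longrightarrow> q * f \<in> jensen_ideal"
  unfolding jensen_ideal_def by (rule ideal_of_mult)

lemma groebner_G0: "groebner G0 T0"
proof
  let ?a = "var 1 :: (4, rat) mpoly" and ?b = "var 2 :: (4, rat) mpoly"
    and ?c = "var 3 :: (4, rat) mpoly" and ?d = "var 4 :: (4, rat) mpoly"
  define p q r where "p = ?a * ?c * ?d + ?a ^ 2 * ?c - ?a * ?b" and "q = ?a * ?d ^ 2 - ?c"
    and "r = ?a * ?d ^ 4 + ?a * ?c"
  have gens: "p \<in> jensen_ideal" "q \<in> jensen_ideal" "r \<in> jensen_ideal"
    unfolding jensen_ideal_def p_def q_def r_def by (auto intro: ideal_of_base)
  \<comment> \<open>Here s = c (a + d^2) and t = ab + cd^3 - cd^4. The two remaining basis elements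
    are S-polynomials of q with s and of q with t.\<close>
  define s where "s = r - ?d ^ 2 * q"
  define t where "t = (?d + ?a - ?d ^ 2) * s - p"
  have s: "s \<in> jensen_ideal"
    unfolding s_def by (intro gens jensen_ideal_diff jensen_ideal_mult)
  have t: "t \<in> jensen_ideal"
    unfolding t_def by (intro gens s jensen_ideal_diff jensen_ideal_mult)
  have "t \<in> jensen_ideal \<and> s \<in> jensen_ideal \<and> q \<in> jensen_ideal \<and>
      ?d ^ 2 * s - ?c * q \<in> jensen_ideal \<and> ?b * q - ?d ^ 2 * t \<in> jensen_ideal"
    by (intro conjI gens s t jensen_ideal_diff jensen_ideal_mult)
  moreover have "poly_of [(1, (0, 0, 1, 6)), (-1, (0, 0, 1, 5)),
    (-1, (0, 1, 1, 0))] = ?b * q - ?d ^ 2 * t"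
    "poly_of [(1, (0, 0, 2, 0)), (1, (0, 0, 1, 4))] = ?d ^ 2 * s - ?c * q"
    "poly_of [(1, (1, 0, 0, 2)), (-1, (0, 0, 1, 0))] = q"
    "poly_of [(1, (1, 0, 1, 0)), (1, (0, 0, 1, 2))] = s"
    "poly_of [(1, (1, 1, 0, 0)), (1, (0, 0, 1, 3)), (-1, (0, 0, 1, 4))] = t"
    by (simp_all add: t_def s_def p_def q_def r_def var_eq_trm trm_mult single_uminus algebra_simps
      eval_nat_numeral)
  moreover fix g assume "g \<in> set G0"
  ultimately show "poly_of g \<in> jensen_ideal"
    unfolding G0_def by (auto simp del: poly_of_Cons)
qed (use indep_T0 in \<open>auto simp: G0_def T0_def tops_def covering_def reached_def\<close>)

text \<open>Division by \<open>G0\<close> puts every element of N killed by \<open>phi\<close> into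
  the ideal. This takes one positive weight that selects the leading terms of \<open>G0\<close>, and
  (12, 6, 9, 2) is such a weight.\<close>

lemma vanishing_ideal_eq: "vanishing_ideal = jensen_ideal"
proof
  interpret groebner G0 T0 by (rule groebner_G0)
  have "strictly G0 (12, 6, 9, 2)"
    by (simp add: strictly_def G0_def)
  then show "vanishing_ideal \<subseteq> jensen_ideal"
    using normal_form [OF dominant_strictly] by blast
qed (rule jensen_ideal_subset_vanishing_ideal)

lemma groebnerI:
  assumes "list_all (\<lambda>g. phi (poly_of g) = 0) G"
    and "list_all (\<lambda>g. list_all (\<lambda>(c, m). in_N m) g \<and> g \<noteq> [] \<and> fst (hd g) \<noteq> 0) G"
    and "covering (tops G) T" "indep (cells T)"
  shows "groebner G T"
  using assms poly_of_in_vanishing_ideal by unfold_locales (auto simp: list_all_iff vanishing_ideal_eq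
    [symmetric])

lemma groebner_G1: "groebner G1 T1"
proof (rule groebnerI)
  show "list_all (\<lambda>g. phi (poly_of g) = 0) G1"
    unfolding G1_def list.pred_inject(2) by (intro conjI list.pred_inject(1); rule phi_poly_of_0;
      simp; algebra)
  show "covering (tops G1) T1"
    by (simp add: G1_def T1_def tops_def covering_def reached_def upt_rec)
qed (simp_all add: G1_def indep_T1)

lemma groebner_G2: "groebner G2 T2"
proof (rule groebnerI)
  show "list_all (\<lambda>g. phi (poly_of g) = 0) G2"
    unfolding G2_def list.pred_inject(2) by (intro conjI list.pred_inject(1); rule phi_poly_of_0;
      simp; algebra)
  show "covering (tops G2) T2"
    by (simp add: G2_def T2_def tops_def covering_def reached_def upt_rec)
qed (simp_all add: G2_def indep_T2)

lemma groebner_G3: "groebner G3 T3"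
proof (rule groebnerI)
  show "list_all (\<lambda>g. phi (poly_of g) = 0) G3"
    unfolding G3_def list.pred_inject(2) by (intro conjI list.pred_inject(1); rule phi_poly_of_0;
      simp; algebra)
  show "covering (tops G3) T3"
    by (simp add: G3_def T3_def tops_def covering_def reached_def upt_rec)
qed (simp_all add: G3_def indep_T3)

lemma groebner_G4: "groebner G4 T4"
proof (rule groebnerI)
  show "list_all (\<lambda>g. phi (poly_of g) = 0) G4"
    unfolding G4_def list.pred_inject(2) by (intro conjI list.pred_inject(1); rule phi_poly_of_0;
      simp; algebra)
  show "covering (tops G4) T4"
    by (simp add: G4_def T4_def tops_def covering_def reached_def upt_rec)
qed (simp_all add: G4_def indep_T4)

lemma groebner_G5: "groebner G5 T5"
proof (rule groebnerI)
  show "list_all (\<lambda>g. phi (poly_of g) = 0) G5"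
    unfolding G5_def list.pred_inject(2) by (intro conjI list.pred_inject(1); rule phi_poly_of_0;
      simp; algebra)
  show "covering (tops G5) T5"
    by (simp add: G5_def T5_def tops_def covering_def reached_def upt_rec)
qed (simp_all add: G5_def indep_T5)

lemma groebner_G6: "groebner G6 T6"
proof (rule groebnerI)
  show "list_all (\<lambda>g. phi (poly_of g) = 0) G6"
    unfolding G6_def list.pred_inject(2) by (intro conjI list.pred_inject(1); rule phi_poly_of_0;
      simp; algebra)
  show "covering (tops G6) T6"
    by (simp add: G6_def T6_def tops_def covering_def reached_def upt_rec)
qed (simp_all add: G6_def indep_T6)

lemma groebner_G7: "groebner G7 T7"
proof (rule groebnerI)
  show "list_all (\<lambda>g. phi (poly_of g) = 0) G7"
    unfolding G7_def list.pred_inject(2) by (intro conjI list.pred_inject(1); rule phi_poly_of_0;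
      simp; algebra)
  show "covering (tops G7) T7"
    by (simp add: G7_def T7_def tops_def covering_def reached_def upt_rec)
qed (simp_all add: G7_def indep_T7)

lemma groebner_G8: "groebner G8 T8"
proof (rule groebnerI)
  show "list_all (\<lambda>g. phi (poly_of g) = 0) G8"
    unfolding G8_def list.pred_inject(2) by (intro conjI list.pred_inject(1); rule phi_poly_of_0;
      simp; algebra)
  show "covering (tops G8) T8"
    by (simp add: G8_def T8_def tops_def covering_def reached_def upt_rec)
qed (simp_all add: G8_def indep_T8)

lemma groebner_G9: "groebner G9 T9"
proof (rule groebnerI)
  show "list_all (\<lambda>g. phi (poly_of g) = 0) G9"
    unfolding G9_def list.pred_inject(2) by (intro conjI list.pred_inject(1); rule phi_poly_of_0;
      simp; algebra)
  show "covering (tops G9) T9"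
    by (simp add: G9_def T9_def tops_def covering_def reached_def upt_rec)
qed (simp_all add: G9_def indep_T9)

lemma groebner_G10: "groebner G10 T10"
proof (rule groebnerI)
  show "list_all (\<lambda>g. phi (poly_of g) = 0) G10"
    unfolding G10_def list.pred_inject(2) by (intro conjI list.pred_inject(1); rule phi_poly_of_0;
      simp; algebra)
  show "covering (tops G10) T10"
    by (simp add: G10_def T10_def tops_def covering_def reached_def upt_rec)
qed (simp_all add: G10_def indep_T10)

section \<open>The inequalities for the support function and their contradiction\<close>

lemma (in groebner) cone_point:
  assumes "normal_fan P = restricted_groebner_fan jensen_ideal" "strictly G v"
  obtains p where "p \<in> P" "\<And>u q. weakly G u \<Longrightarrow> q \<in> P \<Longrightarrow> weight u \<bullet> q \<le> weight u \<bullet> p"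
proof -
  obtain F where F: "F \<in> nonempty_faces P"
    "groebner_cone jensen_ideal (weight v) \<inter> nonneg_orthant = normal_cone P F"
    using cone_in_fan [OF assms(2)] assms(1) unfolding normal_fan_def by blast
  then obtain p where p: "p \<in> F" "p \<in> P"
    unfolding nonempty_faces_def face_def by blast
  show thesis
  proof (rule that [OF p(2)])
    fix u q assume "weakly G u" "q \<in> P"
    then have "weight u \<in> normal_cone P F"
      unfolding F(2) [symmetric] using ray_in_cone [OF assms(2)] weight_nonneg by (simp add:
        nonneg_orthant_def)
    then show "weight u \<bullet> q \<le> weight u \<bullet> p"
      using \<open>q \<in> P\<close> by (rule normal_cone_max [OF p(1)])
  qed
qed

declare weight.simps [simp del]

theorem theorem1:
  fixes a b c d :: "(4, rat) mpoly"
  assumes "a = var 1" and "b = var 2" and "c = var 3" and "d = var 4"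
  defines "I \<equiv> ideal_of {a * c * d + a^2 * c - a * b, a * d^2 - c, a * d^4 + a * c}"
  shows "\<not> (\<exists>P :: (real^4) set. polyhedron P \<and> normal_fan P = restricted_groebner_fan I)"
proof
  assume "\<exists>P :: (real^4) set. polyhedron P \<and> normal_fan P = restricted_groebner_fan I"
  then obtain P :: "(real^4) set" where P: "normal_fan P = restricted_groebner_fan jensen_ideal"
    by (auto simp: I_def assms jensen_ideal_def)
  \<comment> \<open>Each vector passed below is an integer interior point of its cone. What is kept
    is a point of \<open>P\<close> that is maximal for every weight satisfying \<open>weakly\<close>
    for the corresponding basis.\<close>
  obtain p1 where p1: "p1 \<in> P" "\<And>u q. weakly G1 u \<Longrightarrow> q \<in> P \<Longrightarrow> weight u \<bullet> q \<le> weight u \<bullet> p1"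
    by (rule groebner.cone_point [OF groebner_G1 P, of "(11, 8, 15, 12)"]) (simp_all add: strictly_def
      G1_def)
  obtain p2 where p2: "p2 \<in> P" "\<And>u q. weakly G2 u \<Longrightarrow> q \<in> P \<Longrightarrow> weight u \<bullet> q \<le> weight u \<bullet> p2"
    by (rule groebner.cone_point [OF groebner_G2 P, of "(12, 1, 6, 12)"]) (simp_all add: strictly_def
      G2_def)
  obtain p3 where p3: "p3 \<in> P" "\<And>u q. weakly G3 u \<Longrightarrow> q \<in> P \<Longrightarrow> weight u \<bullet> q \<le> weight u \<bullet> p3"
    by (rule groebner.cone_point [OF groebner_G3 P, of "(8, 1, 3, 9)"]) (simp_all add: strictly_def
      G3_def)
  obtain p4 where p4: "p4 \<in> P" "\<And>u q. weakly G4 u \<Longrightarrow> q \<in> P \<Longrightarrow> weight u \<bullet> q \<le> weight u \<bullet> p4"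
    by (rule groebner.cone_point [OF groebner_G4 P, of "(23, 6, 9, 16)"]) (simp_all add: strictly_def
      G4_def)
  obtain p5 where p5: "p5 \<in> P" "\<And>u q. weakly G5 u \<Longrightarrow> q \<in> P \<Longrightarrow> weight u \<bullet> q \<le> weight u \<bullet> p5"
    by (rule groebner.cone_point [OF groebner_G5 P, of "(27, 1, 6, 27)"]) (simp_all add: strictly_def
      G5_def)
  obtain p6 where p6: "p6 \<in> P" "\<And>u q. weakly G6 u \<Longrightarrow> q \<in> P \<Longrightarrow> weight u \<bullet> q \<le> weight u \<bullet> p6"
    by (rule groebner.cone_point [OF groebner_G6 P, of "(14, 14, 11, 5)"]) (simp_all add: strictly_def
      G6_def)
  obtain p7 where p7: "p7 \<in> P" "\<And>u q. weakly G7 u \<Longrightarrow> q \<in> P \<Longrightarrow> weight u \<bullet> q \<le> weight u \<bullet> p7"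
    by (rule groebner.cone_point [OF groebner_G7 P, of "(29, 2, 6, 11)"]) (simp_all add: strictly_def
      G7_def)
  obtain p8 where p8: "p8 \<in> P" "\<And>u q. weakly G8 u \<Longrightarrow> q \<in> P \<Longrightarrow> weight u \<bullet> q \<le> weight u \<bullet> p8"
    by (rule groebner.cone_point [OF groebner_G8 P, of "(58, 5, 11, 33)"]) (simp_all add: strictly_def
      G8_def)
  obtain p9 where p9: "p9 \<in> P" "\<And>u q. weakly G9 u \<Longrightarrow> q \<in> P \<Longrightarrow> weight u \<bullet> q \<le> weight u \<bullet> p9"
    by (rule groebner.cone_point [OF groebner_G9 P, of "(40, 7, 11, 29)"]) (simp_all add: strictly_def
      G9_def)
  obtain p10 where p10: "p10 \<in> P" "\<And>u q. weakly G10 u \<Longrightarrow> q \<in> P \<Longrightarrow> weight u \<bullet> q \<le> weight u \<bullet> p10"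
    by (rule groebner.cone_point [OF groebner_G10 P, of "(12, 9, 7, 7)"]) (simp_all add: strictly_def
      G10_def)
  \<comment> \<open>A Farkas certificate: the weight on each line satisfies \<open>weakly\<close>
    for the basis of the point on the right. With the right multipliers, the weights attached to any
    one point have equal sums on both sides; at \<open>p10\<close> for instance (2,3,2,1) +
    (3,1,1,2) = (1,3,2,1) + (4,1,1,2), all with multiplier 1/2. The line comparing \<open>p9\<close>
    with \<open>p6\<close> has a positive multiplier, so it can be reversed.\<close>
  have
    "weight (4, 0, 1, 4) \<bullet> p5 \<le> weight (4, 0, 1, 4) \<bullet> p3"
    "weight (2, 4, 3, 1) \<bullet> p6 \<le> weight (2, 4, 3, 1) \<bullet> p1"
    "weight (2, 0, 1, 1) \<bullet> p1 \<le> weight (2, 0, 1, 1) \<bullet> p2"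
    "weight (2, 1, 1, 1) \<bullet> p7 \<le> weight (2, 1, 1, 1) \<bullet> p4"
    "weight (2, 3, 2, 1) \<bullet> p10 \<le> weight (2, 3, 2, 1) \<bullet> p6"
    "weight (3, 0, 1, 2) \<bullet> p2 \<le> weight (3, 0, 1, 2) \<bullet> p4"
    "weight (2, 3, 2, 1) \<bullet> p9 \<le> weight (2, 3, 2, 1) \<bullet> p6"
    "weight (1, 3, 2, 1) \<bullet> p4 \<le> weight (1, 3, 2, 1) \<bullet> p10"
    "weight (2, 1, 1, 2) \<bullet> p9 \<le> weight (2, 1, 1, 2) \<bullet> p4"
    "weight (4, 0, 1, 1) \<bullet> p7 \<le> weight (4, 0, 1, 1) \<bullet> p6"
    "weight (1, 1, 1, 1) \<bullet> p4 \<le> weight (1, 1, 1, 1) \<bullet> p1"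
    "weight (6, 0, 1, 3) \<bullet> p7 \<le> weight (6, 0, 1, 3) \<bullet> p8"
    "weight (1, 3, 2, 1) \<bullet> p1 \<le> weight (1, 3, 2, 1) \<bullet> p9"
    "weight (3, 1, 1, 1) \<bullet> p6 \<le> weight (3, 1, 1, 1) \<bullet> p7"
    "weight (4, 0, 1, 5) \<bullet> p3 \<le> weight (4, 0, 1, 5) \<bullet> p5"
    "weight (3, 0, 1, 3) \<bullet> p3 \<le> weight (3, 0, 1, 3) \<bullet> p2"
    "weight (3, 1, 1, 2) \<bullet> p10 \<le> weight (3, 1, 1, 2) \<bullet> p8"
    "weight (4, 1, 1, 2) \<bullet> p8 \<le> weight (4, 1, 1, 2) \<bullet> p10"
    "weight (5, 0, 1, 3) \<bullet> p8 \<le> weight (5, 0, 1, 3) \<bullet> p4"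
    "weight (2, 0, 1, 3) \<bullet> p2 \<le> weight (2, 0, 1, 3) \<bullet> p3"
    "weight (5, 0, 1, 4) \<bullet> p4 \<le> weight (5, 0, 1, 4) \<bullet> p5"
    "weight (6, 0, 1, 5) \<bullet> p5 \<le> weight (6, 0, 1, 5) \<bullet> p9"
    "weight (4, 0, 1, 2) \<bullet> p4 \<le> weight (4, 0, 1, 2) \<bullet> p7"
    using p1(1) p2(1) p3(1) p4(1) p5(1) p6(1) p7(1) p8(1) p9(1) p10(1)
    by (simp_all add: p1(2) p2(2) p3(2) p4(2) p5(2) p6(2) p7(2) p8(2) p9(2) p10(2) weakly_def G1_def
      G2_def G3_def G4_def G5_def G6_def G7_def G8_def G9_def G10_def)
  \<comment> \<open>With multipliers 1, 1/2 and (once) 3/2 these inequalities add up to \<open>0 \<le> 0\<close>.\<close>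
  then have eq: "weight (2, 3, 2, 1) \<bullet> p6 \<le> weight (2, 3, 2, 1) \<bullet> p9"
    unfolding inner_weight by simp
  \<comment> \<open>By \<open>eq\<close>, \<open>p9\<close> attains the maximum that
    \<open>p6\<close> attains for this ray of the sixth cone. As \<open>p9\<close> is also maximal
    for an interior vector of the ninth cone, one normal cone contains both weights.\<close>
  have "p9 \<in> face (weight (2, 3, 2, 1)) P"
    using p9(1) p6(2) [of "(2, 3, 2, 1)"] eq by (force simp: face_def weakly_def G6_def)
  moreover have "p9 \<in> face (weight (40, 7, 11, 29)) P"
    using p9 by (simp add: face_def weakly_def G9_def)
  ultimately obtain N where "N \<in> normal_fan P" "weight (2, 3, 2, 1) \<in> N" "weight (40, 7, 11, 29) \<in> N"
    by (rule common_normal_cone)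
  \<comment> \<open>The entry \<open>G9 ! 1\<close> is led by c^3 d, which has weight 7 at
    (2,3,2,1), while its tail monomial ab^2 has weight 8. So this ray violates the ninth
    cone.\<close>
  then show False
    unfolding P
    by (intro groebner.not_in_common_cone [OF groebner_G9, of "(40, 7, 11, 29)" "G9 ! 1" "(2, 3, 2,
      1)" N])
      (simp_all add: strictly_def tops_def G9_def)
qed

end
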